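(* Let $1\le k\le n$ be integers, let $1\le p<\infty$, and let $u_1,\ldots,u_n\in\mathbb{R}^k$. Put $r=\big(\frac1k\sum_{i=1}^n|u_i|^p\big)^{1/p}$ and assume $r>0$. Then $$\Big|\{x\in\mathbb{R}^k:\ |\langle x,u_i\rangle|\le 1\text{ for every } i=1,\ldots,n\}\Big|^{1/k}\ \ge\ \begin{cases}\dfrac{2\sqrt2}{\sqrt p\, r} & \text{if } p\ge 2,\\[2mm] \dfrac1r & \text{if } 1\le p\le 2.\end{cases}$$
   Context: $|u|$ denotes the Euclidean norm of $u\in\mathbb{R}^k$, $\langle\cdot,\cdot\rangle$ the standard inner product, and $|K|$ the $k$-dimensional Lebesgue measure (volume) of a set $K\subset\mathbb{R}^k$. *)

theory Defs
  imports "HOL-Analysis.Analysis"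
begin

end

theory Submission
  imports Defs "HOL-Probability.Distributions"
begin

text \<open>
  By a theorem of Prekopa, marginals of log-concave functions are log-concave. So if \<open>G\<close> is even and
  log-concave, its integral over the hyperplane \<open>\<langle>x, u\<rangle> = t\<close> is a non-increasing function of
  \<open>\<bar>t\<bar>\<close>, and replacing a factor \<open>\<phi> \<langle>x, u\<rangle>\<close>, where \<open>0 \<le> \<phi> \<le> 1\<close> and
  \<open>\<integral> \<phi> \<le> 2\<close>, by the indicator of the slab \<open>\<bar>\<langle>x, u\<rangle>\<bar> \<le> 1\<close> can only increase the
  integral (Kanter's peakedness argument). Doing this for every \<open>u\<^sub>i\<close> with
  \<open>\<phi> t = exp (- c \<bar>t\<bar>\<^sup>p)\<close> bounds \<open>\<bar>K\<bar>\<close> from below by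
  \<open>\<integral> exp (- c \<Sum>\<^sub>i \<bar>\<langle>x, u\<^sub>i\<rangle>\<bar>\<^sup>p) dx\<close>. The Gibbs variational principle, tested with a
  centred Gaussian of standard deviation \<open>\<sigma>\<close>, bounds this integral from below in terms of the absolute
  Gaussian moment of order \<open>p\<close> and \<open>\<Sum>\<^sub>i \<bar>u\<^sub>i\<bar>\<^sup>p\<close>; then \<open>\<sigma>\<close> is optimised. For
  \<open>p \<ge> 2\<close> the choice \<open>c = pi / 4\<close> is sharp at \<open>p = 2\<close>; for \<open>p \<le> 2\<close> the choice \<open>c = 1\<close> suffices.
\<close>

section \<open>Marginals of log-concave functions\<close>

text \<open>The slabs are exchanged one at a time, so at an intermediate stage some factors are
  still \<open>\<phi>\<close> and others are already indicators. The mixed product must remain even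
  and log-concave, so \<open>\<phi>\<close> itself has to be log-concave; for
  \<open>exp (- c * \<bar>t\<bar> powr p)\<close> this is where \<open>1 \<le> p\<close> enters.
  When the vectors do not span, the product of the factors is constant along some directions and its
  marginals are infinite. A box cut-off therefore accompanies the whole exchange and is removed by
  monotone convergence. Both values of \<open>c\<close> come from the left end of their range of
  \<open>p\<close>: the integral of \<open>\<phi>\<close> is exactly 2 for \<open>c = 1\<close> at
  \<open>p = 1\<close> and for \<open>c = pi / 4\<close> at \<open>p = 2\<close>, and a bound by 2
  persists when \<open>p\<close> grows. The exact Gaussian moment is avoided for
  \<open>p \<ge> 2\<close>. The cruder \<open>(3 / 2 * p) powr (p / 2 - 1)\<close> equals 1 at
  \<open>p = 2\<close>, so nothing is lost there (the cube, with the unit vectors as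
  \<open>u i\<close>, gives equality), and for larger \<open>p\<close> the inequality
  \<open>6 \<le> pi * exp 1\<close> absorbs the loss.\<close>

text \<open>Layer-cake formula: Tonelli on the region under the graph. It reduces inequalities
  between integrals to inequalities between lengths of superlevel sets.\<close>

lemma nn_integral_superlevel:
  fixes f :: "real \<Rightarrow> real"
  assumes [measurable]: "f \<in> borel_measurable borel" and "\<And>x. 0 \<le> f x"
  shows "(\<integral>\<^sup>+x. ennreal (f x) \<partial>lborel) =
    (\<integral>\<^sup>+t. indicator {0<..} t * emeasure lborel {x. t < f x} \<partial>lborel)"
proof -
  have "(\<integral>\<^sup>+x. ennreal (f x) \<partial>lborel) =
      (\<integral>\<^sup>+x. (\<integral>\<^sup>+t. indicator {0<..} t * indicator {x. t < f x} x \<partial>lborel) \<partial>lborel)"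
  proof (intro nn_integral_cong)
    fix x
    have "(\<integral>\<^sup>+t. indicator {0<..} t * indicator {x. t < f x} x \<partial>lborel) =
        (\<integral>\<^sup>+t. indicator {0<..<f x} t \<partial>lborel)"
      by (intro nn_integral_cong) (auto split: split_indicator)
    also have "\<dots> = ennreal (f x)" using assms(2)[of x] by simp
    finally show "ennreal (f x) = (\<integral>\<^sup>+t. indicator {0<..} t * indicator {x. t < f x} x \<partial>lborel)" ..
  qed
  also have "\<dots> = (\<integral>\<^sup>+t. (\<integral>\<^sup>+x. indicator {0<..} t * indicator {x. t < f x} x \<partial>lborel) \<partial>lborel)"
    by (rule lborel_pair.Fubini') simp
  also have "\<dots> = (\<integral>\<^sup>+t. indicator {0<..} t * emeasure lborel {x. t < f x} \<partial>lborel)"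
    by (intro nn_integral_cong) (simp add: nn_integral_cmult)
  finally show ?thesis .
qed

text \<open>Bounded convex sets of reals are intervals with possibly missing endpoints. The set
  \<open>a A + b B\<close> is convex and has points arbitrarily close to both of its extremes, so it
  contains the open interval between them, whose length is the left-hand side or more.
  \<open>C\<close> is any measurable superset, so a superlevel set can take its place.\<close>

lemma brunn_minkowski_interval:
  fixes A B C :: "real set"
  assumes A: "convex A" "bounded A" "A \<noteq> {}" and B: "convex B" "bounded B" "B \<noteq> {}"
    and C: "C \<in> sets lborel" and ab: "0 < a" "0 < b"
    and AB: "\<And>x y. x \<in> A \<Longrightarrow> y \<in> B \<Longrightarrow> a * x + b * y \<in> C"
  shows "ennreal a * emeasure lborel A + ennreal b * emeasure lborel B \<le> emeasure lborel C"
proof -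
  have bdd: "bdd_above A" "bdd_below A" "bdd_above B" "bdd_below B"
    using A B by (auto simp: bounded_imp_bdd_above bounded_imp_bdd_below)
  have le: "Inf A \<le> Sup A" "Inf B \<le> Sup B"
    using A B bdd by (auto intro!: cInf_le_cSup)
  have eA: "emeasure lborel A \<le> ennreal (Sup A - Inf A)"
  proof -
    have "emeasure lborel A \<le> emeasure lborel {Inf A..Sup A}"
      using bdd by (intro emeasure_mono) (auto intro: cInf_lower cSup_upper)
    then show ?thesis using le by simp
  qed
  have eB: "emeasure lborel B \<le> ennreal (Sup B - Inf B)"
  proof -
    have "emeasure lborel B \<le> emeasure lborel {Inf B..Sup B}"
      using bdd by (intro emeasure_mono) (auto intro: cInf_lower cSup_upper)
    then show ?thesis using le by simp
  qed
  have sub: "{a * Inf A + b * Inf B <..< a * Sup A + b * Sup B} \<subseteq> C"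
  proof
    fix z assume z: "z \<in> {a * Inf A + b * Inf B <..< a * Sup A + b * Sup B}"
    define S where "S = (\<lambda>(x,y). a * x + b * y) ` (A \<times> B)"
    have cS: "convex S"
    proof -
      have "linear (\<lambda>(x,y). a * x + b * (y::real))"
        by (rule linearI) (auto simp: algebra_simps)
      then show ?thesis unfolding S_def by (intro convex_linear_image convex_Times A B)
    qed
    have "\<exists>s\<in>S. s < z"
    proof -
      \<comment> \<open>The gap between \<open>z\<close> and the lower extreme is shared out: moving
        both infima up by \<open>e\<close> lands exactly on \<open>z\<close>.\<close>
      define e where "e = (z - (a * Inf A + b * Inf B)) / (a + b)"
      have e: "e > 0" "(a+b) * e = z - (a * Inf A + b * Inf B)" using z ab by (auto simp: e_def)
      obtain x where x: "x \<in> A" "x < Inf A + e"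
        using A(3) bdd e cInf_less_iff[of A "Inf A + e"] by auto
      obtain y where y: "y \<in> B" "y < Inf B + e"
        using B(3) bdd e cInf_less_iff[of B "Inf B + e"] by auto
      have "a * x + b * y < a * (Inf A + e) + b * (Inf B + e)"
        using x y ab by (intro add_strict_mono mult_strict_left_mono) auto
      also have "\<dots> = z" using e(2) by (simp add: algebra_simps)
      finally show ?thesis using x y unfolding S_def by force
    qed
    moreover have "\<exists>s\<in>S. z < s"
    proof -
      define e where "e = ((a * Sup A + b * Sup B) - z) / (a + b)"
      have e: "e > 0" "(a+b) * e = (a * Sup A + b * Sup B) - z" using z ab by (auto simp: e_def)
      obtain x where x: "x \<in> A" "Sup A - e < x"
        using A(3) bdd e less_cSup_iff[of A "Sup A - e"] by auto
      obtain y where y: "y \<in> B" "Sup B - e < y"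
        using B(3) bdd e less_cSup_iff[of B "Sup B - e"] by auto
      have "z = a * (Sup A - e) + b * (Sup B - e)" using e(2) by (simp add: algebra_simps)
      also have "\<dots> < a * x + b * y"
        using x y ab by (intro add_strict_mono mult_strict_left_mono) auto
      finally show ?thesis using x y unfolding S_def by force
    qed
    ultimately have "z \<in> S"
      using cS is_interval_convex_1 mem_is_interval_1_I by (metis less_imp_le)
    then show "z \<in> C" using AB by (auto simp: S_def)
  qed
  have "ennreal a * emeasure lborel A + ennreal b * emeasure lborel B
      \<le> ennreal a * ennreal (Sup A - Inf A) + ennreal b * ennreal (Sup B - Inf B)"
    by (intro add_mono mult_left_mono eA eB) auto
  also have "\<dots> = ennreal (a * Sup A + b * Sup B - (a * Inf A + b * Inf B))"
    using ab le by (simp add: algebra_simps flip: ennreal_mult ennreal_plus)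
  also have "\<dots> = emeasure lborel {a * Inf A + b * Inf B <..< a * Sup A + b * Sup B}"
    using ab le by (simp add: add_mono)
  also have "\<dots> \<le> emeasure lborel C"
    using sub C by (intro emeasure_mono) auto
  finally show ?thesis .
qed

text \<open>The hypothesis on \<open>h\<close> says
  \<open>a {f > t} + b {g > t} \<subseteq> {h > t}\<close>, which has content only if both sets on
  the left are nonempty. With both suprema equal to 1 they are nonempty for the same levels
  \<open>t < 1\<close> and empty for \<open>t \<ge> 1\<close>. The gain is an arithmetic mean of the
  integrals rather than a geometric one.\<close>

lemma prekopa_normalized:
  fixes f g h :: "real \<Rightarrow> real"
  assumes [measurable]: "f \<in> borel_measurable borel" "g \<in> borel_measurable borel" "h \<in> borel_measurable borel"
    and f: "\<And>x. 0 \<le> f x" "\<And>x. f x \<le> 1" "\<And>t. 0 \<le> t \<Longrightarrow> convex {x. t < f x}"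
      "\<And>x. R < \<bar>x\<bar> \<Longrightarrow> f x = 0" "\<And>t. t < 1 \<Longrightarrow> \<exists>x. t < f x"
    and g: "\<And>x. 0 \<le> g x" "\<And>x. g x \<le> 1" "\<And>t. 0 \<le> t \<Longrightarrow> convex {x. t < g x}"
      "\<And>x. R < \<bar>x\<bar> \<Longrightarrow> g x = 0" "\<And>t. t < 1 \<Longrightarrow> \<exists>x. t < g x"
    and h: "\<And>x. 0 \<le> h x" "\<And>x y. f x powr a * g y powr b \<le> h (a * x + b * y)"
    and ab: "0 < a" "0 < b" "a + b = 1"
  shows "ennreal a * (\<integral>\<^sup>+x. f x \<partial>lborel) + ennreal b * (\<integral>\<^sup>+x. g x \<partial>lborel) \<le> (\<integral>\<^sup>+x. h x \<partial>lborel)"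
proof -
  have bd: "bounded {x. t < f x}" "bounded {x. t < g x}" if "0 < t" for t
  proof -
    have "{x. t < f x} \<subseteq> cball 0 R" "{x. t < g x} \<subseteq> cball 0 R"
      using f(4) g(4) that by (force simp: not_less[symmetric])+
    then show "bounded {x. t < f x}" "bounded {x. t < g x}"
      by (meson bounded_cball bounded_subset)+
  qed
  have *: "ennreal a * (indicator {0<..} t * emeasure lborel {x. t < f x}) +
        ennreal b * (indicator {0<..} t * emeasure lborel {x. t < g x})
      \<le> indicator {0<..} t * emeasure lborel {x. t < h x}" for t
  proof (cases "0 < t \<and> t < 1")
    case True
    have "ennreal a * emeasure lborel {x. t < f x} + ennreal b * emeasure lborel {x. t < g x}
        \<le> emeasure lborel {x. t < h x}"
    proof (rule brunn_minkowski_interval)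
      show "{x. t < f x} \<noteq> {}" "{x. t < g x} \<noteq> {}" using f(5) g(5) True by auto
      fix x y assume "x \<in> {x. t < f x}" "y \<in> {x. t < g x}"
      then have "t powr a * t powr b < f x powr a * g y powr b"
        using True ab by (intro mult_strict_mono powr_less_mono2) auto
      moreover have "t powr a * t powr b = t" using True ab by (simp flip: powr_add)
      ultimately show "a * x + b * y \<in> {x. t < h x}" using h(2)[of x y] by auto
    qed (use True f g bd ab in auto)
    then show ?thesis using True by simp
  next
    case False
    then consider "t \<le> 0" | "1 \<le> t" by linarith
    then show ?thesis
    proof cases
      case 2
      then have "{x. t < f x} = {}" "{x. t < g x} = {}"
        using f(2) g(2) by (force simp: not_less intro: order_trans)+
      then show ?thesis by simp
    qed simp
  qed
  have "ennreal a * (\<integral>\<^sup>+x. f x \<partial>lborel) + ennreal b * (\<integral>\<^sup>+x. g x \<partial>lborel) =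
     (\<integral>\<^sup>+t. ennreal a * (indicator {0<..} t * emeasure lborel {x. t < f x}) +
        ennreal b * (indicator {0<..} t * emeasure lborel {x. t < g x}) \<partial>lborel)"
    using f(1) g(1) by (simp add: nn_integral_superlevel nn_integral_add nn_integral_cmult)
  also have "\<dots> \<le> (\<integral>\<^sup>+t. indicator {0<..} t * emeasure lborel {x. t < h x} \<partial>lborel)"
    by (intro nn_integral_mono *)
  also have "\<dots> = (\<integral>\<^sup>+x. h x \<partial>lborel)"
    using h(1) by (simp add: nn_integral_superlevel)
  finally show ?thesis .
qed

lemma integrable_bounded_support:
  fixes f :: "real \<Rightarrow> real"
  assumes [measurable]: "f \<in> borel_measurable borel"
    and "\<And>x. \<bar>f x\<bar> \<le> B" "\<And>x. R < \<bar>x\<bar> \<Longrightarrow> f x = 0"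
  shows "integrable lborel f"
proof (rule integrableI_bounded_set[where A="{-R..R}" and B=B])
  show "AE x in lborel. x \<in> {- R..R} \<longrightarrow> norm (f x) \<le> B" using assms(2) by auto
  show "AE x in lborel. x \<notin> {- R..R} \<longrightarrow> f x = 0"
  proof (intro AE_I2 impI)
    fix x assume "x \<notin> {-R..R}"
    then have "R < \<bar>x\<bar>" by auto
    then show "f x = 0" by (rule assms(3))
  qed
qed (auto simp: emeasure_lborel_Icc_eq)

text \<open>Dividing \<open>f\<close> and \<open>g\<close> by their suprema gives the normalised
  case, and weighted AM-GM turns its sum into the product. \<open>h\<close> is assumed integrable so
  that its Bochner integral is not the default value 0.\<close>

lemma prekopa:
  fixes f g h :: "real \<Rightarrow> real"
  assumes m[measurable]: "f \<in> borel_measurable borel" "g \<in> borel_measurable borel" "h \<in> borel_measurable borel"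
    and f: "\<And>x. 0 \<le> f x" "\<And>x. f x \<le> B" "\<And>t. 0 \<le> t \<Longrightarrow> convex {x. t < f x}"
      "\<And>x. R < \<bar>x\<bar> \<Longrightarrow> f x = 0"
    and g: "\<And>x. 0 \<le> g x" "\<And>x. g x \<le> B" "\<And>t. 0 \<le> t \<Longrightarrow> convex {x. t < g x}"
      "\<And>x. R < \<bar>x\<bar> \<Longrightarrow> g x = 0"
    and h: "\<And>x. 0 \<le> h x" "integrable lborel h" "\<And>x y. f x powr a * g y powr b \<le> h (a * x + b * y)"
    and ab: "0 < a" "0 < b" "a + b = 1"
  shows "(\<integral>x. f x \<partial>lborel) powr a * (\<integral>x. g x \<partial>lborel) powr b \<le> (\<integral>x. h x \<partial>lborel)"
proof (cases "(\<integral>x. f x \<partial>lborel) = 0 \<or> (\<integral>x. g x \<partial>lborel) = 0")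
  case True
  then show ?thesis using h by (auto simp: integral_nonneg_AE)
next
  case False
  have intf: "integrable lborel f" and intg: "integrable lborel g"
    using f g by (auto intro!: integrable_bounded_support[where B=B and R=R])
  have F0: "(\<integral>x. f x \<partial>lborel) > 0" and G0: "(\<integral>x. g x \<partial>lborel) > 0"
    using False f g by (auto simp: order_less_le integral_nonneg_AE)
  define F where "F = (SUP x. f x)"
  define G where "G = (SUP x. g x)"
  have bf: "bdd_above (range f)" and bg: "bdd_above (range g)"
    using f(2) g(2) by (auto intro!: bdd_aboveI2)
  have fF: "f x \<le> F" and gG: "g x \<le> G" for x
    unfolding F_def G_def using bf bg by (auto intro: cSUP_upper)
  have "F > 0"
  proof (rule ccontr)
    assume "\<not> F > 0"
    then have "f x = 0" for x using fF[of x] f(1)[of x] by linarith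
    then have "f = (\<lambda>x. 0)" by auto
    then show False using False by simp
  qed
  have "G > 0"
  proof (rule ccontr)
    assume "\<not> G > 0"
    then have "g x = 0" for x using gG[of x] g(1)[of x] by linarith
    then have "g = (\<lambda>x. 0)" by auto
    then show False using False by simp
  qed
  \<comment> \<open>The hypothesis on \<open>h\<close> is homogeneous, so \<open>h\<close> has to be
    divided by exactly this factor.\<close>
  define D where "D = F powr a * G powr b"
  have D: "D > 0" using \<open>F > 0\<close> \<open>G > 0\<close> by (simp add: D_def)
  have "ennreal a * (\<integral>\<^sup>+x. f x / F \<partial>lborel) + ennreal b * (\<integral>\<^sup>+x. g x / G \<partial>lborel) \<le> (\<integral>\<^sup>+x. h x / D \<partial>lborel)"
  proof (rule prekopa_normalized[where R=R])
    show "\<exists>x. t < f x / F" if "t < 1" for t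
    proof -
      have "t * F < (SUP x. f x)" using that \<open>F > 0\<close> by (simp add: F_def[symmetric])
      then obtain x where "t * F < f x" using bf by (auto simp: less_cSUP_iff)
      then show ?thesis using \<open>F > 0\<close> by (auto simp: pos_less_divide_eq)
    qed
    show "\<exists>x. t < g x / G" if "t < 1" for t
    proof -
      have "t * G < (SUP x. g x)" using that \<open>G > 0\<close> by (simp add: G_def[symmetric])
      then obtain x where "t * G < g x" using bg by (auto simp: less_cSUP_iff)
      then show ?thesis using \<open>G > 0\<close> by (auto simp: pos_less_divide_eq)
    qed
    show "convex {x. t < f x / F}" "convex {x. t < g x / G}" if "0 \<le> t" for t
      using f(3)[of "t * F"] g(3)[of "t * G"] that \<open>F > 0\<close> \<open>G > 0\<close> by (auto simp: pos_less_divide_eq)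
    show "(f x / F) powr a * (g y / G) powr b \<le> h (a * x + b * y) / D" for x y
    proof -
      have "(f x / F) powr a * (g y / G) powr b = f x powr a * g y powr b / D"
        using f(1)[of x] g(1)[of y] \<open>F > 0\<close> \<open>G > 0\<close> by (simp add: powr_divide D_def)
      also have "\<dots> \<le> h (a * x + b * y) / D" using h(3) D by (intro divide_right_mono) auto
      finally show ?thesis .
    qed
  qed (use f g h D \<open>F > 0\<close> \<open>G > 0\<close> fF gG ab in auto)
  moreover have "(\<integral>\<^sup>+x. f x / F \<partial>lborel) = ennreal ((\<integral>x. f x \<partial>lborel) / F)"
    using f(1) intf \<open>F > 0\<close> by (subst nn_integral_eq_integral) auto
  moreover have "(\<integral>\<^sup>+x. g x / G \<partial>lborel) = ennreal ((\<integral>x. g x \<partial>lborel) / G)"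
    using g(1) intg \<open>G > 0\<close> by (subst nn_integral_eq_integral) auto
  moreover have "(\<integral>\<^sup>+x. h x / D \<partial>lborel) = ennreal ((\<integral>x. h x \<partial>lborel) / D)"
    using h D by (subst nn_integral_eq_integral) auto
  ultimately have "ennreal (a * ((\<integral>x. f x \<partial>lborel) / F) + b * ((\<integral>x. g x \<partial>lborel) / G))
     \<le> ennreal ((\<integral>x. h x \<partial>lborel) / D)"
    using ab F0 G0 \<open>F > 0\<close> \<open>G > 0\<close> by (simp flip: ennreal_mult ennreal_plus)
  then have le: "a * ((\<integral>x. f x \<partial>lborel) / F) + b * ((\<integral>x. g x \<partial>lborel) / G) \<le> (\<integral>x. h x \<partial>lborel) / D"
    using h D by (subst (asm) ennreal_le_iff) (auto intro!: integral_nonneg_AE)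
  have "((\<integral>x. f x \<partial>lborel) / F) powr a * ((\<integral>x. g x \<partial>lborel) / G) powr b
    \<le> a * ((\<integral>x. f x \<partial>lborel) / F) + b * ((\<integral>x. g x \<partial>lborel) / G)"
    using F0 G0 \<open>F > 0\<close> \<open>G > 0\<close> ab by (intro Youngs_inequality_0) auto
  also note le
  finally have "(\<integral>x. f x \<partial>lborel) powr a * (\<integral>x. g x \<partial>lborel) powr b / D \<le> (\<integral>x. h x \<partial>lborel) / D"
    using F0 G0 \<open>F > 0\<close> \<open>G > 0\<close> by (simp add: powr_divide D_def)
  then show ?thesis using D by (simp add: divide_le_cancel)
qed

text \<open>
  The points of the product space \<open>PiM I (\<lambda>_. lborel)\<close> are the functions that are
  \<open>undefined\<close> outside \<open>I\<close>; convex combinations preserve this, whereas negation does not, hence the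
  explicit restriction in \<open>even_density\<close>. Boundedness and support in a box are included so that all
  marginals are finite.
\<close>

definition log_concave_density :: "'i set \<Rightarrow> (('i \<Rightarrow> real) \<Rightarrow> real) \<Rightarrow> bool" where
  "log_concave_density I G \<longleftrightarrow>
     G \<in> borel_measurable (PiM I (\<lambda>_. lborel)) \<and>
     (\<forall>x\<in>extensional I. 0 \<le> G x) \<and>
     (\<exists>B. \<forall>x\<in>extensional I. G x \<le> B) \<and>
     (\<exists>R. \<forall>x\<in>extensional I. \<forall>i\<in>I. R < \<bar>x i\<bar> \<longrightarrow> G x = 0) \<and>
     (\<forall>x\<in>extensional I. \<forall>y\<in>extensional I. \<forall>a b. 0 < a \<longrightarrow> 0 < b \<longrightarrow> a + b = 1 \<longrightarrow>
        G x powr a * G y powr b \<le> G (\<lambda>i. a * x i + b * y i))"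

definition even_density :: "'i set \<Rightarrow> (('i \<Rightarrow> real) \<Rightarrow> real) \<Rightarrow> bool" where
  "even_density I G \<longleftrightarrow> (\<forall>x\<in>extensional I. G (\<lambda>i\<in>I. - x i) = G x)"

interpretation lborel_PiM: product_sigma_finite "\<lambda>_. lborel :: real measure"
  by unfold_locales

lemma extensional_convex_comb:
  fixes x y :: "'i \<Rightarrow> real"
  assumes "x \<in> extensional I" "y \<in> extensional I" "a + b = 1"
  shows "(\<lambda>i. a * x i + b * y i) \<in> extensional I"
  using assms by (auto simp: extensional_def simp flip: distrib_right)

lemma convex_superlevel_log_concave:
  fixes g :: "real \<Rightarrow> real"
  assumes "\<And>x. 0 \<le> g x" "0 \<le> t"
    and "\<And>x y a b. 0 < a \<Longrightarrow> 0 < b \<Longrightarrow> a + b = 1 \<Longrightarrow> g x powr a * g y powr b \<le> g (a * x + b * y)"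
  shows "convex {x. t < g x}"
proof (rule convexI)
  fix x y u v :: real
  assume *: "x \<in> {x. t < g x}" "y \<in> {x. t < g x}" "0 \<le> u" "0 \<le> v" "u + v = 1"
  show "u *\<^sub>R x + v *\<^sub>R y \<in> {x. t < g x}"
  proof (cases "u = 0 \<or> v = 0")
    case False
    then have uv: "0 < u" "0 < v" using * by auto
    have "t = t powr u * t powr v" using * assms(2) by (simp flip: powr_add)
    also have "\<dots> < g x powr u * g y powr v"
      using * uv assms(2) by (intro mult_strict_mono powr_less_mono2) auto
    also have "\<dots> \<le> g (u * x + v * y)" using uv * assms(3) by auto
    finally show ?thesis by simp
  qed (use * in auto)
qed

text \<open>Prekopa's inequality on the fibres over \<open>x\<close>, \<open>y\<close> and their
  convex combination; the superlevel sets on one fibre are convex because \<open>G\<close> is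
  log-concave along it. Integrability is recorded so that the marginal can later be exchanged with a
  nonnegative integral.\<close>

lemma log_concave_density_marginal:
  assumes G: "log_concave_density (insert i I) G" and i: "i \<notin> I"
  shows "log_concave_density I (\<lambda>x. \<integral>y. G (x(i := y)) \<partial>lborel)"
    and "x \<in> extensional I \<Longrightarrow> integrable lborel (\<lambda>y. G (x(i := y)))"
proof -
  have m[measurable]: "G \<in> borel_measurable (PiM (insert i I) (\<lambda>_. lborel))"
    and nn: "\<And>x. x \<in> extensional (insert i I) \<Longrightarrow> 0 \<le> G x"
    and lc: "\<And>x y a b. x \<in> extensional (insert i I) \<Longrightarrow> y \<in> extensional (insert i I) \<Longrightarrow> 0 < a \<Longrightarrow> 0 < b \<Longrightarrow>
      a + b = 1 \<Longrightarrow> G x powr a * G y powr b \<le> G (\<lambda>i. a * x i + b * y i)"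
    using G by (auto simp: log_concave_density_def)
  obtain B where B: "\<And>x. x \<in> extensional (insert i I) \<Longrightarrow> G x \<le> B"
    using G by (auto simp: log_concave_density_def)
  obtain R where R: "\<And>x k. x \<in> extensional (insert i I) \<Longrightarrow> k \<in> insert i I \<Longrightarrow> R < \<bar>x k\<bar> \<Longrightarrow> G x = 0"
    using G unfolding log_concave_density_def by blast
  have ext: "x(i := y) \<in> extensional (insert i I)" if "x \<in> extensional I"
    for x :: "'a \<Rightarrow> real" and y :: real
    using that by (auto simp: extensional_def)
  have mx[measurable]: "(\<lambda>y. G (x(i := y))) \<in> borel_measurable lborel" if "x \<in> extensional I" for x
  proof -
    have "(\<lambda>y. x(i := y)) \<in> measurable lborel (PiM (insert i I) (\<lambda>_. lborel))"
      using that i by (intro measurable_component_update) (auto simp: space_PiM PiE_def)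
    then show ?thesis by (rule measurable_compose[OF _ m])
  qed
  have int: "integrable lborel (\<lambda>y. G (x(i := y)))" if "x \<in> extensional I" for x
    using that by (intro integrable_bounded_support[where B=B and R=R])
      (auto simp: ext nn B abs_of_nonneg intro: R)
  then show "x \<in> extensional I \<Longrightarrow> integrable lborel (\<lambda>y. G (x(i := y)))" by simp
  have ne: "\<exists>x :: 'a \<Rightarrow> real. x \<in> extensional I" by (intro exI[of _ "\<lambda>_. undefined"]) (auto simp: extensional_def)
  have B0: "0 \<le> B"
  proof -
    obtain x :: "'a \<Rightarrow> real" where "x \<in> extensional I" using ne by blast
    then show ?thesis using nn[OF ext[of x 0]] B[OF ext[of x 0]] by linarith
  qed
  show "log_concave_density I (\<lambda>x. \<integral>y. G (x(i := y)) \<partial>lborel)"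
    unfolding log_concave_density_def
  proof (intro conjI ballI allI impI)
    have "(\<lambda>(x, y). G (x(i := y))) \<in> borel_measurable (PiM I (\<lambda>_. lborel) \<Otimes>\<^sub>M lborel)"
      using measurable_comp[OF measurable_add_dim[where M="\<lambda>_. lborel"] m] by (simp add: comp_def split_def)
    then show "(\<lambda>x. \<integral>y. G (x(i := y)) \<partial>lborel) \<in> borel_measurable (PiM I (\<lambda>_. lborel))"
      by (intro lborel.borel_measurable_lebesgue_integral) auto
    show "0 \<le> (\<integral>y. G (x(i := y)) \<partial>lborel)" if "x \<in> extensional I" for x
      using that by (intro integral_nonneg_AE) (auto simp: nn ext)
    show "\<exists>C. \<forall>x\<in>extensional I. (\<integral>y. G (x(i := y)) \<partial>lborel) \<le> C"
    proof (intro exI ballI)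
      fix x :: "'a \<Rightarrow> real" assume x: "x \<in> extensional I"
      show "(\<integral>y. G (x(i := y)) \<partial>lborel) \<le> (\<integral>y. B * indicator {-R..R} y \<partial>lborel)"
      proof (rule integral_mono)
        show "G (x(i := y)) \<le> B * indicator {-R..R} y" for y
          using B[OF ext[OF x, of y]] R[OF ext[OF x, of y], of i] by (auto split: split_indicator)
      qed (use int x in \<open>auto simp: emeasure_lborel_Icc_eq\<close>)
    qed
    show "\<exists>R. \<forall>x\<in>extensional I. \<forall>k\<in>I. R < \<bar>x k\<bar> \<longrightarrow> (\<integral>y. G (x(i := y)) \<partial>lborel) = 0"
    proof (intro exI[of _ R] ballI impI)
      fix x :: "'a \<Rightarrow> real" and k assume *: "x \<in> extensional I" "k \<in> I" "R < \<bar>x k\<bar>"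
      moreover have "k \<noteq> i" using * i by auto
      ultimately have "G (x(i := y)) = 0" for y using R[OF ext, of x k y] by simp
      then show "(\<integral>y. G (x(i := y)) \<partial>lborel) = 0" by simp
    qed
    fix x y :: "'a \<Rightarrow> real" and a b :: real
    assume xy: "x \<in> extensional I" "y \<in> extensional I" and ab: "0 < a" "0 < b" "a + b = 1"
    let ?z = "\<lambda>i. a * x i + b * y i"
    have z: "?z \<in> extensional I" using xy ab by (intro extensional_convex_comb)
    have upd: "(\<lambda>k. a' * (w(i := s)) k + b' * (w'(i := t)) k) = (\<lambda>k. a' * w k + b' * w' k)(i := a' * s + b' * t)"
      for a' b' s t and w w' :: "'a \<Rightarrow> real" by auto
    have conv: "convex {s. t < G (w(i := s))}" if "w \<in> extensional I" "0 \<le> t" for w t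
    proof (rule convex_superlevel_log_concave)
      fix s s' a' b' :: real assume ab': "0 < a'" "0 < b'" "a' + b' = 1"
      have "(\<lambda>k. a' * w k + b' * w k) = w" using ab' by (auto simp flip: distrib_right)
      then show "G (w(i := s)) powr a' * G (w(i := s')) powr b' \<le> G (w(i := a' * s + b' * s'))"
        using lc[OF ext ext ab', of w w s s'] that unfolding upd by simp
    qed (use that nn ext in auto)
    show "(\<integral>s. G (x(i := s)) \<partial>lborel) powr a * (\<integral>s. G (y(i := s)) \<partial>lborel) powr b \<le> (\<integral>s. G (?z(i := s)) \<partial>lborel)"
    proof (rule prekopa[where B=B and R=R])
      show "G (x(i := s)) powr a * G (y(i := t)) powr b \<le> G (?z(i := a * s + b * t))" for s t
        using lc[OF ext ext ab, of x y s t] xy unfolding upd by simp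
      show "G (x(i := s)) = 0" "G (y(i := s)) = 0" if "R < \<bar>s\<bar>" for s
        using R[OF ext, of _ i s] xy that by auto
    qed (use xy z ab nn B ext int conv mx in auto)
  qed
qed

lemma even_density_marginal:
  assumes G: "even_density (insert i I) G" and i: "i \<notin> I"
  shows "even_density I (\<lambda>x. \<integral>y. G (x(i := y)) \<partial>lborel)"
  unfolding even_density_def
proof
  fix x :: "'a \<Rightarrow> real" assume x: "x \<in> extensional I"
  have "(\<integral>y. G ((\<lambda>k\<in>I. - x k)(i := y)) \<partial>lborel) = (\<integral>y. G ((\<lambda>k\<in>I. - x k)(i := - y)) \<partial>lborel)"
    by (subst lborel_integral_real_affine[where c="-1" and t=0]) auto
  also have "\<dots> = (\<integral>y. G (x(i := y)) \<partial>lborel)"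
  proof (rule Bochner_Integration.integral_cong[OF refl])
    fix y
    have e: "x(i := y) \<in> extensional (insert i I)" using x by (auto simp: extensional_def)
    have "(\<lambda>k\<in>I. - x k)(i := - y) = (\<lambda>k\<in>insert i I. - (x(i := y)) k)" using i by auto
    then show "G ((\<lambda>k\<in>I. - x k)(i := - y)) = G (x(i := y))"
      using bspec[OF G[unfolded even_density_def] e] by simp
  qed
  finally show "(\<integral>y. G ((\<lambda>k\<in>I. - x k)(i := y)) \<partial>lborel) = (\<integral>y. G (x(i := y)) \<partial>lborel)" .
qed

section \<open>Peakedness\<close>

text \<open>Since \<open>g\<close> decreases in \<open>\<bar>t\<bar>\<close>, the product of
  \<open>indicator {-1..1} t - \<phi> t\<close> and \<open>g t - g 1\<close> is nonnegative
  everywhere. Integrating it leaves the error \<open>g 1 * (2 - \<integral> \<phi>)\<close>, which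
  has the right sign. Every term is kept on the side where it is nonnegative, and the finite
  quantity \<open>2 * g 1\<close> is cancelled at the end.\<close>

lemma peaked_unimodal:
  fixes \<phi> g :: "real \<Rightarrow> real"
  assumes [measurable]: "\<phi> \<in> borel_measurable borel" "g \<in> borel_measurable borel"
    and \<phi>: "\<And>t. 0 \<le> \<phi> t" "\<And>t. \<phi> t \<le> 1" "(\<integral>\<^sup>+t. \<phi> t \<partial>lborel) \<le> 2"
    and g: "\<And>t. 0 \<le> g t" "\<And>s t. \<bar>s\<bar> \<le> \<bar>t\<bar> \<Longrightarrow> g t \<le> g s"
  shows "(\<integral>\<^sup>+t. \<phi> t * g t \<partial>lborel) \<le> (\<integral>\<^sup>+t. indicator {-1..1::real} t * g t \<partial>lborel)"
proof -
  have pt: "\<phi> t * g t + indicator {-1..1::real} t * g 1 \<le> indicator {-1..1::real} t * g t + \<phi> t * g 1" for t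
  proof (cases "\<bar>t\<bar> \<le> 1")
    case True
    then have "0 \<le> (1 - \<phi> t) * (g t - g 1)" using \<phi>(2)[of t] g(2)[of t 1] by auto
    moreover have "(indicator {-1..1::real} t :: real) = 1" using True by (auto simp: indicator_def)
    ultimately show ?thesis by (simp add: algebra_simps)
  next
    case False
    then have "indicator {-1..1::real} t = (0::real)" by (auto simp: indicator_def)
    moreover have "\<phi> t * g t \<le> \<phi> t * g 1" using False \<phi>(1) g(2)[of 1 t] by (intro mult_left_mono) auto
    ultimately show ?thesis by simp
  qed
  have "(\<integral>\<^sup>+t. indicator {-1..1::real} t * g 1 \<partial>lborel) = (\<integral>\<^sup>+t. ennreal (g 1) * indicator {-1..1::real} t \<partial>lborel)"
    by (intro nn_integral_cong) (auto split: split_indicator)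
  also have "\<dots> = ennreal (2 * g 1)"
    using g(1)[of 1] by (simp add: nn_integral_cmult_indicator ennreal_mult mult.commute del: ennreal_numeral)
  finally have g1: "(\<integral>\<^sup>+t. indicator {-1..1::real} t * g 1 \<partial>lborel) = ennreal (2 * g 1)" .
  have "(\<integral>\<^sup>+t. \<phi> t * g t \<partial>lborel) + ennreal (2 * g 1) =
      (\<integral>\<^sup>+t. \<phi> t * g t \<partial>lborel) + (\<integral>\<^sup>+t. indicator {-1..1::real} t * g 1 \<partial>lborel)"
    by (simp only: g1)
  also have "\<dots> = (\<integral>\<^sup>+t. ennreal (\<phi> t * g t + indicator {-1..1::real} t * g 1) \<partial>lborel)"
    using \<phi> g by (subst nn_integral_add[symmetric]) auto
  also have "\<dots> \<le> (\<integral>\<^sup>+t. ennreal (indicator {-1..1::real} t * g t + \<phi> t * g 1) \<partial>lborel)"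
    using pt by (intro nn_integral_mono ennreal_leI)
  also have "\<dots> = (\<integral>\<^sup>+t. indicator {-1..1::real} t * g t \<partial>lborel) + (\<integral>\<^sup>+t. \<phi> t * g 1 \<partial>lborel)"
    using \<phi> g by (subst nn_integral_add[symmetric]) auto
  also have "(\<integral>\<^sup>+t. \<phi> t * g 1 \<partial>lborel) = (\<integral>\<^sup>+t. \<phi> t \<partial>lborel) * ennreal (g 1)"
    using \<phi> g by (simp add: ennreal_mult nn_integral_multc)
  also have "\<dots> \<le> 2 * ennreal (g 1)" using \<phi>(3) by (intro mult_right_mono) auto
  also have "2 * ennreal (g 1) = ennreal (2 * g 1)" using g(1)[of 1] by (simp add: ennreal_mult)
  finally have "ennreal (2 * g 1) + (\<integral>\<^sup>+t. \<phi> t * g t \<partial>lborel) \<le>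
      ennreal (2 * g 1) + (\<integral>\<^sup>+t. indicator {-1..1::real} t * g t \<partial>lborel)"
    by (simp add: add.commute add_left_mono)
  then show ?thesis unfolding ennreal_add_left_cancel_le by simp
qed

text \<open>The weight sees only coordinate \<open>j\<close>, so the other coordinates are
  integrated out one by one, each marginal being again even and log-concave. What remains is one
  variable, where even and log-concave imply non-increasing in \<open>\<bar>t\<bar>\<close>.\<close>

lemma peaked_coordinate:
  fixes \<phi> :: "real \<Rightarrow> real"
  assumes "finite J" and "j \<notin> J"
    and "log_concave_density (insert j J) G" and "even_density (insert j J) G"
    and \<phi>[measurable]: "\<phi> \<in> borel_measurable borel"
    and \<phi>': "\<And>t. 0 \<le> \<phi> t" "\<And>t. \<phi> t \<le> 1" "(\<integral>\<^sup>+t. \<phi> t \<partial>lborel) \<le> 2"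
  shows "(\<integral>\<^sup>+x. \<phi> (x j) * G x \<partial>PiM (insert j J) (\<lambda>_. lborel)) \<le>
    (\<integral>\<^sup>+x. indicator {-1..1} (x j) * G x \<partial>PiM (insert j J) (\<lambda>_. lborel))"
  using assms(1-4)
proof (induction J arbitrary: G rule: finite_induct)
  case empty
  \<comment> \<open>\<open>e t\<close> is the only point with coordinate \<open>t\<close> in the
    product space over \<open>{j}\<close>; through it \<open>G\<close> becomes a function of one
    real variable.\<close>
  define e where "e = (\<lambda>t k. if k = j then t else (undefined::real))"
  have e: "e t \<in> extensional {j}" for t by (auto simp: e_def extensional_def)
  have eq: "G (e (x j)) = G x" if "x \<in> extensional {j}" for x
  proof -
    have "e (x j) = x" using that by (auto simp: e_def extensional_def)
    then show ?thesis by simp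
  qed
  have m[measurable]: "G \<in> borel_measurable (PiM {j} (\<lambda>_. lborel))"
    and nn: "\<And>x. x \<in> extensional {j} \<Longrightarrow> 0 \<le> G x"
    and lc: "\<And>x y a b. x \<in> extensional {j} \<Longrightarrow> y \<in> extensional {j} \<Longrightarrow> 0 < a \<Longrightarrow> 0 < b \<Longrightarrow>
      a + b = 1 \<Longrightarrow> G x powr a * G y powr b \<le> G (\<lambda>i. a * x i + b * y i)"
    and ev: "\<And>x. x \<in> extensional {j} \<Longrightarrow> G (\<lambda>i\<in>{j}. - x i) = G x"
    using empty by (auto simp: log_concave_density_def even_density_def)
  have em[measurable]: "e \<in> measurable borel (PiM {j} (\<lambda>_. lborel))"
  proof -
    have "e = (\<lambda>t. \<lambda>k\<in>{j}. t)" by (auto simp: e_def fun_eq_iff)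
    then show ?thesis by simp
  qed
  have ev': "G (e (- t)) = G (e t)" for t
  proof -
    have "(\<lambda>i\<in>{j}. - e t i) = e (-t)" by (auto simp: e_def)
    then show ?thesis using ev[OF e[of t]] by simp
  qed
  have mono: "G (e t) \<le> G (e s)" if st: "\<bar>s\<bar> \<le> \<bar>t\<bar>" for s t
  proof (cases "\<bar>s\<bar> = \<bar>t\<bar>")
    case True
    then have "s = t \<or> s = - t" by linarith
    then show ?thesis using ev' by auto
  next
    case False
    then have t: "t \<noteq> 0" "\<bar>s / t\<bar> < 1" using st by auto
    \<comment> \<open>The weights that write \<open>s\<close> as a convex combination of
      \<open>t\<close> and \<open>- t\<close>, two points where \<open>G\<close> has the same
      value.\<close>
    define a where "a = (1 + s / t) / 2"
    define b where "b = (1 - s / t) / 2"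
    have "0 < a" "0 < b" using abs_less_iff[THEN iffD1, OF t(2)] by (auto simp: a_def b_def)
    moreover have ab1: "a + b = 1" by (simp add: a_def b_def field_simps)
    ultimately have ab: "0 < a" "0 < b" "a + b = 1" by auto
    have "a * t + b * (- t) = s" using t(1) by (simp add: a_def b_def field_simps)
    then have "(\<lambda>k. a * e t k + b * e (- t) k) = e s"
      using ab1 by (simp add: e_def fun_eq_iff flip: distrib_right)
    then have "G (e t) powr a * G (e (-t)) powr b \<le> G (e s)"
      using lc[OF e e ab, of t "- t"] by simp
    moreover have "G (e t) powr a * G (e (-t)) powr b = G (e t)"
      using ab nn[OF e[of t]] by (simp add: ev' flip: powr_add)
    ultimately show ?thesis by simp
  qed
  have "(\<integral>\<^sup>+x. \<phi> (x j) * G x \<partial>PiM {j} (\<lambda>_. lborel)) = (\<integral>\<^sup>+x. (\<lambda>t. ennreal (\<phi> t * G (e t))) (x j) \<partial>PiM {j} (\<lambda>_. lborel))"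
    by (intro nn_integral_cong) (simp add: space_PiM PiE_def eq)
  also have "\<dots> = (\<integral>\<^sup>+t. \<phi> t * G (e t) \<partial>lborel)"
    by (subst lborel_PiM.product_nn_integral_singleton) auto
  also have "\<dots> \<le> (\<integral>\<^sup>+t. indicator {-1..1} t * G (e t) \<partial>lborel)"
    using \<phi>' by (intro peaked_unimodal mono) (auto simp: nn e)
  also have "\<dots> = (\<integral>\<^sup>+x. (\<lambda>t. ennreal (indicator {-1..1} t * G (e t))) (x j) \<partial>PiM {j} (\<lambda>_. lborel))"
    by (subst lborel_PiM.product_nn_integral_singleton) auto
  also have "\<dots> = (\<integral>\<^sup>+x. indicator {-1..1} (x j) * G x \<partial>PiM {j} (\<lambda>_. lborel))"
    by (intro nn_integral_cong) (simp add: space_PiM PiE_def eq)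
  finally show ?case .
next
  case (insert i J)
  have ins: "insert j (insert i J) = insert i (insert j J)" by auto
  have i: "i \<notin> insert j J" using insert by auto
  have G: "log_concave_density (insert i (insert j J)) G" "even_density (insert i (insert j J)) G"
    using insert by (simp_all add: ins)
  have m[measurable]: "G \<in> borel_measurable (PiM (insert i (insert j J)) (\<lambda>_. lborel))"
    and nn: "\<And>x. x \<in> extensional (insert i (insert j J)) \<Longrightarrow> 0 \<le> G x"
    using G by (auto simp: log_concave_density_def)
  let ?H = "\<lambda>x. \<integral>y. G (x(i := y)) \<partial>lborel"
  \<comment> \<open>Stated for an arbitrary weight, because it is applied both to
    \<open>\<phi>\<close> and to the indicator.\<close>
  have *: "(\<integral>\<^sup>+x. \<psi> (x j) * G x \<partial>PiM (insert i (insert j J)) (\<lambda>_. lborel))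
     = (\<integral>\<^sup>+x. \<psi> (x j) * ?H x \<partial>PiM (insert j J) (\<lambda>_. lborel))"
    if [measurable]: "\<psi> \<in> borel_measurable borel" and \<psi>: "\<And>t. 0 \<le> \<psi> t" for \<psi> :: "real \<Rightarrow> real"
  proof -
    have "(\<integral>\<^sup>+x. \<psi> (x j) * G x \<partial>PiM (insert i (insert j J)) (\<lambda>_. lborel))
      = (\<integral>\<^sup>+x. (\<integral>\<^sup>+y. \<psi> ((x(i := y)) j) * G (x(i := y)) \<partial>lborel) \<partial>PiM (insert j J) (\<lambda>_. lborel))"
      using insert.hyps i by (subst lborel_PiM.product_nn_integral_insert) auto
    also have "\<dots> = (\<integral>\<^sup>+x. \<psi> (x j) * ?H x \<partial>PiM (insert j J) (\<lambda>_. lborel))"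
    proof (rule nn_integral_cong)
      fix x :: "'a \<Rightarrow> real" assume "x \<in> space (PiM (insert j J) (\<lambda>_. lborel))"
      then have x: "x \<in> extensional (insert j J)" by (simp add: space_PiM PiE_def)
      have int: "integrable lborel (\<lambda>y. G (x(i := y)))"
        using log_concave_density_marginal(2)[OF G(1) i x] .
      have nn': "0 \<le> G (x(i := y))" for y using x by (intro nn) (auto simp: extensional_def)
      have "(\<integral>\<^sup>+y. \<psi> ((x(i := y)) j) * G (x(i := y)) \<partial>lborel) = (\<integral>\<^sup>+y. \<psi> (x j) * G (x(i := y)) \<partial>lborel)"
        using i by (intro nn_integral_cong) auto
      also have "\<dots> = ennreal (\<integral>y. \<psi> (x j) * G (x(i := y)) \<partial>lborel)"
        using int nn' \<psi> by (intro nn_integral_eq_integral) auto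
      finally show "(\<integral>\<^sup>+y. \<psi> ((x(i := y)) j) * G (x(i := y)) \<partial>lborel) = ennreal (\<psi> (x j) * ?H x)"
        by simp
    qed
    finally show ?thesis .
  qed
  have "(\<integral>\<^sup>+x. \<phi> (x j) * ?H x \<partial>PiM (insert j J) (\<lambda>_. lborel)) \<le>
    (\<integral>\<^sup>+x. indicator {-1..1} (x j) * ?H x \<partial>PiM (insert j J) (\<lambda>_. lborel))"
    using insert.prems G i by (intro insert.IH log_concave_density_marginal even_density_marginal) auto
  then show ?case unfolding ins using \<phi>' by (simp add: *)
qed

section \<open>Straightening a linear form into a coordinate\<close>

text \<open>The substitution that solves a linear form for coordinate \<open>j\<close>. If
  \<open>c = v j\<close>, then the form with coefficients \<open>v\<close>, evaluated at the image
  of \<open>x\<close>, is just \<open>x j\<close>.\<close>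

definition shear :: "'i set \<Rightarrow> 'i \<Rightarrow> ('i \<Rightarrow> real) \<Rightarrow> real \<Rightarrow> ('i \<Rightarrow> real) \<Rightarrow> 'i \<Rightarrow> real" where
  "shear J j v c =
     (\<lambda>x. \<lambda>i\<in>insert j J. if i = j then (x j - (\<Sum>i\<in>J. v i * x i)) / c else x i)"

text \<open>The map is triangular with determinant \<open>1 / c\<close>: for fixed coordinates in
  \<open>J\<close> it is affine in coordinate \<open>j\<close>, so Tonelli and a one-dimensional
  substitution suffice.\<close>

lemma nn_integral_PiM_shear:
  fixes v :: "'i \<Rightarrow> real" and c :: real
  assumes J: "finite J" "j \<notin> J" and c: "c \<noteq> 0"
    and F[measurable]: "F \<in> borel_measurable (PiM (insert j J) (\<lambda>_. lborel))"
  shows "(\<integral>\<^sup>+x. F x \<partial>PiM (insert j J) (\<lambda>_. lborel)) =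
    ennreal (1 / \<bar>c\<bar>) * (\<integral>\<^sup>+x. F (shear J j v c x) \<partial>PiM (insert j J) (\<lambda>_. lborel))"
proof -
  have [measurable]: "shear J j v c \<in> measurable (PiM (insert j J) (\<lambda>_. lborel)) (PiM (insert j J) (\<lambda>_. lborel))"
    unfolding shear_def using J by (intro measurable_restrict) simp
  have upd[measurable]: "(\<lambda>y. x(j := y)) \<in> measurable lborel (PiM (insert j J) (\<lambda>_. lborel))"
    if "x \<in> space (PiM J (\<lambda>_. lborel))" for x :: "'i \<Rightarrow> real"
    using that J by (intro measurable_component_update)
  have "(\<integral>\<^sup>+x. F x \<partial>PiM (insert j J) (\<lambda>_. lborel)) =
      (\<integral>\<^sup>+x. (\<integral>\<^sup>+y. F (x(j := y)) \<partial>lborel) \<partial>PiM J (\<lambda>_. lborel))"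
    using J by (intro lborel_PiM.product_nn_integral_insert) auto
  also have "\<dots> = (\<integral>\<^sup>+x. ennreal (1 / \<bar>c\<bar>) * (\<integral>\<^sup>+y. F (shear J j v c (x(j := y))) \<partial>lborel) \<partial>PiM J (\<lambda>_. lborel))"
  proof (rule nn_integral_cong)
    fix x :: "'i \<Rightarrow> real" assume x: "x \<in> space (PiM J (\<lambda>_. lborel))"
    let ?s = "\<Sum>i\<in>J. v i * x i"
    have m: "(\<lambda>y. F (x(j := y))) \<in> borel_measurable borel"
      using measurable_compose[OF upd[OF x] F] by simp
    have e: "shear J j v c (x(j := y)) = x(j := - ?s / c + (1 / c) * y)" for y
    proof
      fix k
      have "(\<Sum>i\<in>J. v i * (x(j := y)) i) = ?s" using J by (intro sum.cong) auto
      then show "shear J j v c (x(j := y)) k = (x(j := - ?s / c + (1 / c) * y)) k"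
        using x c by (auto simp: shear_def space_PiM PiE_def extensional_def field_simps)
    qed
    have "(\<integral>\<^sup>+y. F (x(j := y)) \<partial>lborel) = ennreal \<bar>1 / c\<bar> * (\<integral>\<^sup>+y. F (x(j := - ?s / c + (1 / c) * y)) \<partial>lborel)"
      using c by (intro nn_integral_real_affine[OF m]) auto
    then show "(\<integral>\<^sup>+y. F (x(j := y)) \<partial>lborel) = ennreal (1 / \<bar>c\<bar>) * (\<integral>\<^sup>+y. F (shear J j v c (x(j := y))) \<partial>lborel)"
      by (simp only: e abs_divide abs_one)
  qed
  also have "\<dots> = (\<integral>\<^sup>+x. (\<integral>\<^sup>+y. ennreal (1 / \<bar>c\<bar>) * F (shear J j v c (x(j := y))) \<partial>lborel) \<partial>PiM J (\<lambda>_. lborel))"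
  proof (rule nn_integral_cong)
    fix x :: "'i \<Rightarrow> real" assume x: "x \<in> space (PiM J (\<lambda>_. lborel))"
    have "(\<lambda>x. F (shear J j v c x)) \<in> borel_measurable (PiM (insert j J) (\<lambda>_. lborel))" by measurable
    from measurable_compose[OF upd[OF x] this]
    show "ennreal (1 / \<bar>c\<bar>) * (\<integral>\<^sup>+y. F (shear J j v c (x(j := y))) \<partial>lborel) =
       (\<integral>\<^sup>+y. ennreal (1 / \<bar>c\<bar>) * F (shear J j v c (x(j := y))) \<partial>lborel)"
      by (subst nn_integral_cmult) auto
  qed
  also have "\<dots> = (\<integral>\<^sup>+x. ennreal (1 / \<bar>c\<bar>) * F (shear J j v c x) \<partial>PiM (insert j J) (\<lambda>_. lborel))"
    using J by (intro lborel_PiM.product_nn_integral_insert[symmetric]) auto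
  also have "\<dots> = ennreal (1 / \<bar>c\<bar>) * (\<integral>\<^sup>+x. F (shear J j v c x) \<partial>PiM (insert j J) (\<lambda>_. lborel))"
    by (intro nn_integral_cmult) measurable
  finally show ?thesis .
qed

lemma log_concave_density_shear:
  fixes v :: "'i \<Rightarrow> real" and c :: real
  assumes J: "finite J" "j \<notin> J" and c: "c \<noteq> 0"
    and G: "log_concave_density (insert j J) G"
  shows "log_concave_density (insert j J) (\<lambda>x. G (shear J j v c x))"
proof -
  let ?I = "insert j J"
  have m[measurable]: "G \<in> borel_measurable (PiM ?I (\<lambda>_. lborel))"
    and nn: "\<And>x. x \<in> extensional ?I \<Longrightarrow> 0 \<le> G x"
    and lc: "\<And>x y a b. x \<in> extensional ?I \<Longrightarrow> y \<in> extensional ?I \<Longrightarrow> 0 < a \<Longrightarrow> 0 < b \<Longrightarrow>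
      a + b = 1 \<Longrightarrow> G x powr a * G y powr b \<le> G (\<lambda>i. a * x i + b * y i)"
    using G by (auto simp: log_concave_density_def)
  obtain B where B: "\<And>x. x \<in> extensional ?I \<Longrightarrow> G x \<le> B"
    using G by (auto simp: log_concave_density_def)
  obtain R where R: "\<And>x k. x \<in> extensional ?I \<Longrightarrow> k \<in> ?I \<Longrightarrow> R < \<bar>x k\<bar> \<Longrightarrow> G x = 0"
    using G unfolding log_concave_density_def by blast
  have ext: "shear J j v c x \<in> extensional ?I" for x by (simp add: shear_def)
  have mS[measurable]: "shear J j v c \<in> measurable (PiM ?I (\<lambda>_. lborel)) (PiM ?I (\<lambda>_. lborel))"
    unfolding shear_def using J by (intro measurable_restrict) simp
  show ?thesis unfolding log_concave_density_def
  proof (intro conjI ballI allI impI)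
    show "\<exists>C. \<forall>x\<in>extensional ?I. G (shear J j v c x) \<le> C" using B ext by auto
    \<comment> \<open>The support is bounded through the inverse map: coordinates in
      \<open>J\<close> are unchanged, and \<open>x j\<close> is recovered as \<open>c\<close> times
      the sheared coordinate plus the sum over \<open>J\<close>.\<close>
    define R' where "R' = \<bar>R\<bar> + \<bar>c\<bar> * \<bar>R\<bar> + (\<Sum>i\<in>J. \<bar>v i\<bar> * \<bar>R\<bar>)"
    show "\<exists>R. \<forall>x\<in>extensional ?I. \<forall>k\<in>?I. R < \<bar>x k\<bar> \<longrightarrow> G (shear J j v c x) = 0"
    proof (intro exI[of _ R'] ballI impI, rule ccontr)
      fix x :: "'i \<Rightarrow> real" and k assume x: "x \<in> extensional ?I" "k \<in> ?I" "R' < \<bar>x k\<bar>" "G (shear J j v c x) \<noteq> 0"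
      have bd: "\<bar>shear J j v c x i\<bar> \<le> \<bar>R\<bar>" if "i \<in> ?I" for i
        using R[OF ext, of i x] x(4) that by force
      have xJ: "\<bar>x i\<bar> \<le> \<bar>R\<bar>" if "i \<in> J" for i
        using bd[of i] that J by (auto simp: shear_def split: if_splits)
      have "x j = c * shear J j v c x j + (\<Sum>i\<in>J. v i * x i)" using c by (simp add: shear_def)
      also have "\<bar>\<dots>\<bar> \<le> \<bar>c * shear J j v c x j\<bar> + (\<Sum>i\<in>J. \<bar>v i * x i\<bar>)"
        by (intro order_trans[OF abs_triangle_ineq] add_mono sum_abs order_refl)
      also have "\<dots> \<le> \<bar>c\<bar> * \<bar>R\<bar> + (\<Sum>i\<in>J. \<bar>v i\<bar> * \<bar>R\<bar>)"
        unfolding abs_mult using bd[of j] xJ by (intro add_mono sum_mono mult_left_mono) auto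
      finally have "\<bar>x j\<bar> \<le> R'" by (simp add: R'_def)
      moreover have "\<bar>x i\<bar> \<le> R'" if "i \<in> J" for i
        using xJ[OF that] by (simp add: R'_def sum_nonneg add_increasing2)
      ultimately show False using x(2,3) by force
    qed
    fix x y :: "'i \<Rightarrow> real" and a b :: real
    assume xy: "x \<in> extensional ?I" "y \<in> extensional ?I" and ab: "0 < a" "0 < b" "a + b = 1"
    \<comment> \<open>Makes the linearity of the shear hold also at indices outside the product,
      where both sides are \<open>undefined\<close>.\<close>
    have u: "a * undefined + b * undefined = (undefined::real)" using ab by (simp flip: distrib_right)
    have "(\<lambda>i. a * shear J j v c x i + b * shear J j v c y i) = shear J j v c (\<lambda>i. a * x i + b * y i)"
    proof
      fix i
      have "(\<Sum>i\<in>J. v i * (a * x i + b * y i)) = a * (\<Sum>i\<in>J. v i * x i) + b * (\<Sum>i\<in>J. v i * y i)"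
        by (simp add: sum.distrib sum_distrib_left algebra_simps)
      then show "a * shear J j v c x i + b * shear J j v c y i = shear J j v c (\<lambda>i. a * x i + b * y i) i"
        using c u by (simp add: shear_def restrict_def field_simps)
    qed
    then show "G (shear J j v c x) powr a * G (shear J j v c y) powr b \<le> G (shear J j v c (\<lambda>i. a * x i + b * y i))"
      using lc[OF ext ext ab, of x y] by simp
  qed (auto simp: nn ext)
qed

lemma even_density_shear:
  fixes v :: "'i \<Rightarrow> real" and c :: real
  assumes J: "finite J" "j \<notin> J" and G: "even_density (insert j J) G"
  shows "even_density (insert j J) (\<lambda>x. G (shear J j v c x))"
  unfolding even_density_def
proof
  fix x :: "'i \<Rightarrow> real" assume x: "x \<in> extensional (insert j J)"
  have "shear J j v c (\<lambda>i\<in>insert j J. - x i) = (\<lambda>i\<in>insert j J. - shear J j v c x i)"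
  proof
    fix i
    have "(\<Sum>i\<in>J. v i * (\<lambda>i\<in>insert j J. - x i) i) = - (\<Sum>i\<in>J. v i * x i)"
      by (simp add: sum_negf)
    then show "shear J j v c (\<lambda>i\<in>insert j J. - x i) i = (\<lambda>i\<in>insert j J. - shear J j v c x i) i"
      by (simp add: shear_def minus_divide_left)
  qed
  moreover have "shear J j v c x \<in> extensional (insert j J)" by (simp add: shear_def)
  ultimately show "G (shear J j v c (\<lambda>i\<in>insert j J. - x i)) = G (shear J j v c x)"
    using G by (simp add: even_density_def)
qed

text \<open>If some \<open>v j\<close> is nonzero, the shear with \<open>c = v j\<close> turns the
  form into coordinate \<open>j\<close>, and the same Jacobian factor multiplies both sides. If the
  form vanishes, the weights are the constants \<open>\<phi> 0 \<le> 1\<close> and 1.\<close>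

lemma peaked_direction:
  fixes \<phi> :: "real \<Rightarrow> real" and v :: "'i \<Rightarrow> real"
  assumes I: "finite I" and G: "log_concave_density I G" "even_density I G"
    and \<phi>[measurable]: "\<phi> \<in> borel_measurable borel"
    and \<phi>': "\<And>t. 0 \<le> \<phi> t" "\<And>t. \<phi> t \<le> 1" "(\<integral>\<^sup>+t. \<phi> t \<partial>lborel) \<le> 2"
  shows "(\<integral>\<^sup>+x. \<phi> (\<Sum>i\<in>I. v i * x i) * G x \<partial>PiM I (\<lambda>_. lborel)) \<le>
    (\<integral>\<^sup>+x. indicator {-1..1} (\<Sum>i\<in>I. v i * x i) * G x \<partial>PiM I (\<lambda>_. lborel))"
proof (cases "\<forall>i\<in>I. v i = 0")
  case True
  have "0 \<le> G x" if "x \<in> space (PiM I (\<lambda>_. lborel))" for x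
    using that G by (auto simp: log_concave_density_def space_PiM PiE_def)
  then show ?thesis using True \<phi>'(2)[of 0]
    by (intro nn_integral_mono ennreal_leI mult_right_mono) auto
next
  case False
  then obtain j where j: "j \<in> I" "v j \<noteq> 0" by auto
  define J where "J = I - {j}"
  have IJ: "I = insert j J" and J: "finite J" "j \<notin> J" using I j by (auto simp: J_def)
  define S where "S = shear J j v (v j)"
  have [measurable]: "G \<in> borel_measurable (PiM (insert j J) (\<lambda>_. lborel))"
    using G by (simp add: log_concave_density_def IJ)
  have sum: "(\<Sum>i\<in>insert j J. v i * S x i) = x j" for x
  proof -
    have "(\<Sum>i\<in>J. v i * S x i) = (\<Sum>i\<in>J. v i * x i)" using J by (intro sum.cong) (auto simp: S_def shear_def)
    then show ?thesis using J j by (simp add: S_def shear_def)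
  qed
  have *: "(\<integral>\<^sup>+x. \<psi> (\<Sum>i\<in>I. v i * x i) * G x \<partial>PiM I (\<lambda>_. lborel)) =
      ennreal (1 / \<bar>v j\<bar>) * (\<integral>\<^sup>+x. \<psi> (x j) * G (S x) \<partial>PiM (insert j J) (\<lambda>_. lborel))"
    if [measurable]: "\<psi> \<in> borel_measurable borel" for \<psi> :: "real \<Rightarrow> real"
  proof -
    have "(\<integral>\<^sup>+x. \<psi> (\<Sum>i\<in>insert j J. v i * x i) * G x \<partial>PiM (insert j J) (\<lambda>_. lborel)) =
      ennreal (1 / \<bar>v j\<bar>) *
      (\<integral>\<^sup>+x. \<psi> (\<Sum>i\<in>insert j J. v i * S x i) * G (S x) \<partial>PiM (insert j J) (\<lambda>_. lborel))"
      unfolding S_def using J j by (intro nn_integral_PiM_shear) auto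
    then show ?thesis by (simp only: sum IJ)
  qed
  have "log_concave_density (insert j J) (\<lambda>x. G (S x))"
    unfolding S_def using G IJ by (intro log_concave_density_shear J j) auto
  moreover have "even_density (insert j J) (\<lambda>x. G (S x))"
    unfolding S_def using G IJ by (intro even_density_shear J j) auto
  ultimately show ?thesis
    unfolding *[OF \<phi>] *[OF borel_measurable_indicator[OF borel_closed[OF closed_atLeastAtMost]]]
    using \<phi>' J by (intro mult_left_mono peaked_coordinate \<phi>) auto
qed


section \<open>Exchanging all the slabs\<close>

text \<open>A class that contains both the exponential factors and the slab indicators, so that
  mixed products can be treated alike. The bound by 1 keeps densities bounded after
  multiplication.\<close>

definition log_concave_profile :: "(real \<Rightarrow> real) \<Rightarrow> bool" where
  "log_concave_profile f \<longleftrightarrow> f \<in> borel_measurable borel \<and>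
     (\<forall>t. 0 \<le> f t \<and> f t \<le> 1 \<and> f (- t) = f t) \<and>
     (\<forall>s t a b. 0 < a \<longrightarrow> 0 < b \<longrightarrow> a + b = 1 \<longrightarrow> f s powr a * f t powr b \<le> f (a * s + b * t))"

lemma log_concave_profile_indicator: "log_concave_profile (indicator {-R..R})"
  unfolding log_concave_profile_def
proof (intro conjI allI impI)
  fix s t a b :: real assume ab: "0 < a" "0 < b" "a + b = 1"
  show "indicat_real {-R..R} s powr a * indicat_real {-R..R} t powr b \<le> indicat_real {-R..R} (a * s + b * t)"
  proof (cases "s \<in> {-R..R} \<and> t \<in> {-R..R}")
    case True
    then have "a *\<^sub>R s + b *\<^sub>R t \<in> {-R..R}"
      using ab by (intro convexD[OF convex_real_interval(5)]) auto
    then show ?thesis using True by simp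
  qed auto
qed (auto simp: indicator_def)

lemma log_concave_density_mult:
  assumes I: "finite I" and G: "log_concave_density I G" and f: "log_concave_profile f"
  shows "log_concave_density I (\<lambda>x. G x * f (\<Sum>i\<in>I. v i * x i))"
proof -
  have m[measurable]: "G \<in> borel_measurable (PiM I (\<lambda>_. lborel))"
    and nn: "\<And>x. x \<in> extensional I \<Longrightarrow> 0 \<le> G x"
    and lc: "\<And>x y a b. x \<in> extensional I \<Longrightarrow> y \<in> extensional I \<Longrightarrow> 0 < a \<Longrightarrow> 0 < b \<Longrightarrow>
      a + b = 1 \<Longrightarrow> G x powr a * G y powr b \<le> G (\<lambda>i. a * x i + b * y i)"
    using G by (auto simp: log_concave_density_def)
  have mf[measurable]: "f \<in> borel_measurable borel" and fnn: "\<And>t. 0 \<le> f t" and f1: "\<And>t. f t \<le> 1"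
    and fc: "\<And>s t a b. 0 < a \<Longrightarrow> 0 < b \<Longrightarrow> a + b = 1 \<Longrightarrow> f s powr a * f t powr b \<le> f (a * s + b * t)"
    using f by (auto simp: log_concave_profile_def)
  obtain B where B: "\<And>x. x \<in> extensional I \<Longrightarrow> G x \<le> B"
    using G by (auto simp: log_concave_density_def)
  show ?thesis unfolding log_concave_density_def
  proof (intro conjI ballI allI impI)
    show "\<exists>B. \<forall>x\<in>extensional I. G x * f (\<Sum>i\<in>I. v i * x i) \<le> B"
      using mult_mono[OF B f1] nn fnn B by (intro exI[of _ "B * 1"]) (force intro: order_trans)
    show "\<exists>R. \<forall>x\<in>extensional I. \<forall>i\<in>I. R < \<bar>x i\<bar> \<longrightarrow> G x * f (\<Sum>i\<in>I. v i * x i) = 0"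
      using G unfolding log_concave_density_def by (metis mult_zero_left)
    fix x y :: "'a \<Rightarrow> real" and a b :: real
    assume xy: "x \<in> extensional I" "y \<in> extensional I" and ab: "0 < a" "0 < b" "a + b = 1"
    have z: "(\<lambda>i. a * x i + b * y i) \<in> extensional I" using xy ab by (intro extensional_convex_comb)
    let ?X = "\<Sum>i\<in>I. v i * x i" and ?Y = "\<Sum>i\<in>I. v i * y i"
    have e: "(\<Sum>i\<in>I. v i * (a * x i + b * y i)) = a * ?X + b * ?Y"
      by (simp add: sum.distrib sum_distrib_left algebra_simps)
    have "(G x * f ?X) powr a * (G y * f ?Y) powr b = (G x powr a * G y powr b) * (f ?X powr a * f ?Y powr b)"
      using nn xy fnn by (simp add: powr_mult)
    also have "\<dots> \<le> G (\<lambda>i. a * x i + b * y i) * f (a * ?X + b * ?Y)"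
      using nn[OF z] fnn by (intro mult_mono lc fc xy ab) auto
    finally show "(G x * f ?X) powr a * (G y * f ?Y) powr b
      \<le> G (\<lambda>i. a * x i + b * y i) * f (\<Sum>i\<in>I. v i * (a * x i + b * y i))"
      by (simp only: e)
  qed (use nn fnn I in auto)
qed

lemma even_density_mult:
  assumes G: "even_density I G" and f: "log_concave_profile f"
  shows "even_density I (\<lambda>x. G x * f (\<Sum>i\<in>I. v i * x i))"
  unfolding even_density_def
proof
  fix x :: "'a \<Rightarrow> real" assume "x \<in> extensional I"
  then have "G (\<lambda>i\<in>I. - x i) = G x" using G by (simp add: even_density_def)
  moreover have "(\<Sum>i\<in>I. v i * (\<lambda>i\<in>I. - x i) i) = - (\<Sum>i\<in>I. v i * x i)"
    by (simp add: sum_negf)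
  ultimately show "G (\<lambda>i\<in>I. - x i) * f (\<Sum>i\<in>I. v i * (\<lambda>i\<in>I. - x i) i) = G x * f (\<Sum>i\<in>I. v i * x i)"
    using f by (simp only: log_concave_profile_def)
qed

lemma log_concave_density_prod:
  assumes "finite I" "finite T" "log_concave_density I G" "even_density I G" "\<And>s. s \<in> T \<Longrightarrow> log_concave_profile (f s)"
  shows "log_concave_density I (\<lambda>x. G x * (\<Prod>s\<in>T. f s (\<Sum>i\<in>I. w s i * x i)))"
    and "even_density I (\<lambda>x. G x * (\<Prod>s\<in>T. f s (\<Sum>i\<in>I. w s i * x i)))"
  using assms(2,3,4,5)
proof (induction T arbitrary: G rule: finite_induct)
  case (insert s T)
  have e: "(\<lambda>x. G x * (\<Prod>s\<in>insert s T. f s (\<Sum>i\<in>I. w s i * x i)))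
    = (\<lambda>x. G x * f s (\<Sum>i\<in>I. w s i * x i) * (\<Prod>s\<in>T. f s (\<Sum>i\<in>I. w s i * x i)))" for G
    using insert.hyps by (simp add: mult.assoc)
  { case 1 then show ?case unfolding e using assms(1)
      by (intro insert.IH(1) log_concave_density_mult even_density_mult) auto }
  { case 2 then show ?case unfolding e using assms(1)
      by (intro insert.IH(2) log_concave_density_mult even_density_mult) auto }
qed auto

text \<open>The new factor \<open>\<phi>\<close> is first absorbed into \<open>G\<close> while the
  induction hypothesis exchanges the others. Then \<open>G\<close> together with the indicators
  obtained is the even log-concave density against which this last \<open>\<phi>\<close> is
  exchanged.\<close>

lemma peaked_product:
  fixes \<phi> :: "real \<Rightarrow> real"
  assumes I: "finite I" and T: "finite T" and G: "log_concave_density I G" "even_density I G"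
    and \<phi>: "log_concave_profile \<phi>" "(\<integral>\<^sup>+t. \<phi> t \<partial>lborel) \<le> 2"
  shows "(\<integral>\<^sup>+x. G x * (\<Prod>s\<in>T. \<phi> (\<Sum>i\<in>I. w s i * x i)) \<partial>PiM I (\<lambda>_. lborel)) \<le>
    (\<integral>\<^sup>+x. G x * (\<Prod>s\<in>T. indicator {-1..1} (\<Sum>i\<in>I. w s i * x i)) \<partial>PiM I (\<lambda>_. lborel))"
  using T G
proof (induction T arbitrary: G rule: finite_induct)
  case (insert s T)
  let ?I = "\<lambda>x. \<Prod>s\<in>T. indicator {-1..1} (\<Sum>i\<in>I. w s i * x i) :: real"
  have "(\<integral>\<^sup>+x. G x * (\<Prod>s\<in>insert s T. \<phi> (\<Sum>i\<in>I. w s i * x i)) \<partial>PiM I (\<lambda>_. lborel)) =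
    (\<integral>\<^sup>+x. G x * \<phi> (\<Sum>i\<in>I. w s i * x i) * (\<Prod>s\<in>T. \<phi> (\<Sum>i\<in>I. w s i * x i)) \<partial>PiM I (\<lambda>_. lborel))"
    using insert.hyps by (simp add: mult.assoc)
  also have "\<dots> \<le> (\<integral>\<^sup>+x. G x * \<phi> (\<Sum>i\<in>I. w s i * x i) * ?I x \<partial>PiM I (\<lambda>_. lborel))"
    using insert.prems I \<phi> by (intro insert.IH log_concave_density_mult even_density_mult)
  also have "\<dots> = (\<integral>\<^sup>+x. \<phi> (\<Sum>i\<in>I. w s i * x i) * (G x * ?I x) \<partial>PiM I (\<lambda>_. lborel))"
    by (simp add: mult_ac)
  also have "\<dots> \<le> (\<integral>\<^sup>+x. indicator {-1..1} (\<Sum>i\<in>I. w s i * x i) * (G x * ?I x) \<partial>PiM I (\<lambda>_. lborel))"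
    using insert.prems insert.hyps I \<phi>
    by (intro peaked_direction log_concave_density_prod log_concave_profile_indicator)
      (auto simp: log_concave_profile_def)
  also have "\<dots> = (\<integral>\<^sup>+x. G x * (\<Prod>s\<in>insert s T. indicator {-1..1} (\<Sum>i\<in>I. w s i * x i)) \<partial>PiM I (\<lambda>_. lborel))"
    using insert.hyps by (simp add: mult_ac)
  finally show ?case .
qed simp

text \<open>The initial density of the exchange: it supplies the bounded support that the product of
  the factors may lack.\<close>

lemma log_concave_density_box:
  assumes I: "finite I"
  shows "log_concave_density I (\<lambda>x. \<Prod>i\<in>I. indicator {-R..R} (x i))"
    and "even_density I (\<lambda>x. \<Prod>i\<in>I. indicator {-R..R::real} (x i) :: real)"
proof -
  let ?G = "\<lambda>x :: 'a \<Rightarrow> real. \<Prod>i\<in>I. indicator {-R..R} (x i) :: real"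
  have b: "0 \<le> ?G x" "?G x \<le> 1" for x
    by (auto intro!: prod_nonneg prod_le_1 simp: indicator_def)
  show "log_concave_density I ?G"
    unfolding log_concave_density_def
  proof (intro conjI ballI allI impI)
    show "\<exists>B. \<forall>x\<in>extensional I. ?G x \<le> B" using b by blast
    show "\<exists>S. \<forall>x\<in>extensional I. \<forall>i\<in>I. S < \<bar>x i\<bar> \<longrightarrow> ?G x = 0"
    proof (intro exI[of _ R] ballI impI)
      fix x i assume "i \<in> I" "R < \<bar>x i\<bar>"
      then show "?G x = 0" using I by (intro prod_zero bexI[of _ i]) (auto simp: indicator_def)
    qed
    fix x y :: "'a \<Rightarrow> real" and a b :: real
    assume ab: "0 < a" "0 < b" "a + b = 1"
    have "?G x powr a * ?G y powr b
      = (\<Prod>i\<in>I. indicator {-R..R} (x i) powr a * indicator {-R..R} (y i) powr b)"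
      by (simp add: prod.distrib prod_powr_distrib)
    also have "\<dots> \<le> ?G (\<lambda>i. a * x i + b * y i)"
      using log_concave_profile_indicator[of R] ab unfolding log_concave_profile_def
      by (intro prod_mono) auto
    finally show "?G x powr a * ?G y powr b \<le> ?G (\<lambda>i. a * x i + b * y i)" .
  qed (use b in auto)
  show "even_density I ?G"
    unfolding even_density_def by (auto intro!: prod.cong simp: indicator_def)
qed

text \<open>Monotone convergence along growing boxes on the left; on the right the box indicator is
  at most 1 and is dropped. Values are extended, so infinite integrals are covered.\<close>

lemma peaked_slabs:
  fixes \<phi> :: "real \<Rightarrow> real"
  assumes I: "finite I" and T: "finite T"
    and \<phi>: "log_concave_profile \<phi>" "(\<integral>\<^sup>+t. \<phi> t \<partial>lborel) \<le> 2"
  shows "(\<integral>\<^sup>+x. (\<Prod>s\<in>T. \<phi> (\<Sum>i\<in>I. w s i * x i)) \<partial>PiM I (\<lambda>_. lborel)) \<le>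
    (\<integral>\<^sup>+x. ennreal (\<Prod>s\<in>T. indicator {-1..1} (\<Sum>i\<in>I. w s i * x i)) \<partial>PiM I (\<lambda>_. lborel))"
proof -
  let ?G = "\<lambda>(n::nat) (x :: 'a \<Rightarrow> real). \<Prod>i\<in>I. indicator {- real n..real n} (x i) :: real"
  let ?P = "\<lambda>x. \<Prod>s\<in>T. \<phi> (\<Sum>i\<in>I. w s i * x i)"
  let ?Q = "\<lambda>x. \<Prod>s\<in>T. indicator {-1..1} (\<Sum>i\<in>I. w s i * x i) :: real"
  have [measurable]: "\<phi> \<in> borel_measurable borel" and \<phi>nn: "\<And>t. 0 \<le> \<phi> t"
    using \<phi> by (auto simp: log_concave_profile_def)
  have b: "0 \<le> ?G n x" "?G n x \<le> 1" for n x
    by (auto intro!: prod_nonneg prod_le_1 simp: indicator_def)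
  have P: "0 \<le> ?P x" for x using \<phi>nn by (intro prod_nonneg) auto
  have "(\<lambda>n. \<integral>\<^sup>+x. ?G n x * ?P x \<partial>PiM I (\<lambda>_. lborel)) \<longlonglongrightarrow> (\<integral>\<^sup>+x. ?P x \<partial>PiM I (\<lambda>_. lborel))"
  proof (rule nn_integral_LIMSEQ)
    show "incseq (\<lambda>n x. ennreal (?G n x * ?P x))"
      using P unfolding incseq_def le_fun_def
      by (auto intro!: ennreal_leI mult_right_mono prod_mono simp: indicator_def)
    show "(\<lambda>n. ennreal (?G n x * ?P x)) \<longlonglongrightarrow> ennreal (?P x)" for x
    proof (rule tendsto_eventually)
      \<comment> \<open>The sum dominates every \<open>\<bar>x i\<bar>\<close>, so one
        \<open>N\<close> works for all coordinates.\<close>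
      obtain N :: nat where N: "(\<Sum>i\<in>I. \<bar>x i\<bar>) \<le> real N" using real_arch_simple by blast
      show "\<forall>\<^sub>F n in sequentially. ennreal (?G n x * ?P x) = ennreal (?P x)"
        using eventually_ge_at_top[of N]
      proof eventually_elim
        case (elim n)
        have "\<bar>x i\<bar> \<le> real n" if "i \<in> I" for i
          using member_le_sum[of i I "\<lambda>i. \<bar>x i\<bar>"] I that N elim by simp
        then have "?G n x = 1" by (intro prod.neutral) (force simp: indicator_def abs_le_iff)
        then show ?case by simp
      qed
    qed
  qed (use I in measurable)
  moreover have "(\<integral>\<^sup>+x. ?G n x * ?P x \<partial>PiM I (\<lambda>_. lborel)) \<le> (\<integral>\<^sup>+x. ?Q x \<partial>PiM I (\<lambda>_. lborel))" for n
  proof -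
    have "(\<integral>\<^sup>+x. ?G n x * ?P x \<partial>PiM I (\<lambda>_. lborel)) \<le> (\<integral>\<^sup>+x. ?G n x * ?Q x \<partial>PiM I (\<lambda>_. lborel))"
      using I T \<phi> by (intro peaked_product log_concave_density_box)
    also have "\<dots> \<le> (\<integral>\<^sup>+x. ?Q x \<partial>PiM I (\<lambda>_. lborel))"
      using b by (intro nn_integral_mono ennreal_leI mult_left_le_one_le) (auto intro!: prod_nonneg)
    finally show ?thesis .
  qed
  ultimately show ?thesis by (intro LIMSEQ_le_const2) auto
qed

section \<open>Passage from product spaces to Euclidean space\<close>

lemma nn_integral_lborel_PiM:
  fixes f :: "'a::euclidean_space \<Rightarrow> ennreal"
  assumes [measurable]: "f \<in> borel_measurable borel"
  shows "(\<integral>\<^sup>+x. f x \<partial>lborel) = (\<integral>\<^sup>+x. f (\<Sum>b\<in>Basis. x b *\<^sub>R b) \<partial>PiM Basis (\<lambda>_. lborel))"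
  by (subst lborel_eq) (simp add: nn_integral_distr)

lemma peaked_polytope:
  fixes \<phi> :: "real \<Rightarrow> real" and u :: "'s \<Rightarrow> 'a::euclidean_space"
  assumes T: "finite T" and \<phi>: "log_concave_profile \<phi>" "(\<integral>\<^sup>+t. \<phi> t \<partial>lborel) \<le> 2"
  shows "(\<integral>\<^sup>+x. (\<Prod>s\<in>T. \<phi> (x \<bullet> u s)) \<partial>lborel) \<le> emeasure lborel {x. \<forall>s\<in>T. \<bar>x \<bullet> u s\<bar> \<le> 1}"
proof -
  have [measurable]: "\<phi> \<in> borel_measurable borel" using \<phi> by (auto simp: log_concave_profile_def)
  have in_sum: "(\<Sum>b\<in>Basis. x b *\<^sub>R b) \<bullet> u s = (\<Sum>b\<in>Basis. (b \<bullet> u s) * x b)" for x s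
    by (simp add: inner_sum_left mult.commute)
  have "(\<integral>\<^sup>+x. (\<Prod>s\<in>T. \<phi> (x \<bullet> u s)) \<partial>lborel) =
      (\<integral>\<^sup>+x. (\<Prod>s\<in>T. \<phi> (\<Sum>b\<in>Basis. (b \<bullet> u s) * x b)) \<partial>PiM Basis (\<lambda>_. lborel))"
    by (subst nn_integral_lborel_PiM) (auto simp: in_sum)
  also have "\<dots> \<le> (\<integral>\<^sup>+x. ennreal (\<Prod>s\<in>T. indicator {-1..1} (\<Sum>b\<in>Basis. (b \<bullet> u s) * x b)) \<partial>PiM Basis (\<lambda>_. lborel))"
    using T \<phi> by (intro peaked_slabs) auto
  also have "\<dots> = (\<integral>\<^sup>+x. ennreal (\<Prod>s\<in>T. indicator {-1..1} (x \<bullet> u s)) \<partial>lborel)"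
    by (subst nn_integral_lborel_PiM) (auto simp: in_sum)
  also have "\<dots> = (\<integral>\<^sup>+x. indicator {x. \<forall>s\<in>T. \<bar>x \<bullet> u s\<bar> \<le> 1} x \<partial>lborel)"
  proof (rule nn_integral_cong)
    fix x
    show "ennreal (\<Prod>s\<in>T. indicator {-1..1} (x \<bullet> u s)) = indicator {x. \<forall>s\<in>T. \<bar>x \<bullet> u s\<bar> \<le> 1} x"
    proof (cases "\<forall>s\<in>T. \<bar>x \<bullet> u s\<bar> \<le> 1")
      case True
      then have "(\<Prod>s\<in>T. indicat_real {-1..1} (x \<bullet> u s)) = 1"
        by (intro prod.neutral) (auto simp: indicator_def abs_le_iff)
      then show ?thesis using True by simp
    next
      case False
      then obtain s where "s \<in> T" "\<not> \<bar>x \<bullet> u s\<bar> \<le> 1" by auto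
      then have "(\<Prod>s\<in>T. indicat_real {-1..1} (x \<bullet> u s)) = 0"
        using T by (intro prod_zero bexI[of _ s]) (auto simp: indicator_def)
      then show ?thesis using False by simp
    qed
  qed
  also have "\<dots> = emeasure lborel {x. \<forall>s\<in>T. \<bar>x \<bullet> u s\<bar> \<le> 1}"
    using T by (intro nn_integral_indicator) measurable
  finally show ?thesis .
qed

section \<open>Gaussian integrals\<close>

lemma nn_integral_normal_scale:
  fixes f :: "real \<Rightarrow> ennreal"
  assumes [measurable]: "f \<in> borel_measurable borel" and v: "v \<noteq> 0" and \<sigma>: "0 < \<sigma>"
  shows "(\<integral>\<^sup>+y. f (v * y) * normal_density 0 \<sigma> y \<partial>lborel) =
    (\<integral>\<^sup>+t. f t * normal_density 0 (\<sigma> * \<bar>v\<bar>) t \<partial>lborel)"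
proof -
  have d: "normal_density 0 \<sigma> y = \<bar>v\<bar> * normal_density 0 (\<sigma> * \<bar>v\<bar>) (v * y)" for y
    using v \<sigma> by (simp add: normal_density_def real_sqrt_mult power_mult_distrib field_simps)
  have "(\<integral>\<^sup>+t. f t * normal_density 0 (\<sigma> * \<bar>v\<bar>) t \<partial>lborel) =
      \<bar>v\<bar> * (\<integral>\<^sup>+y. f (0 + v * y) * normal_density 0 (\<sigma> * \<bar>v\<bar>) (0 + v * y) \<partial>lborel)"
    using v by (intro nn_integral_real_affine) auto
  also have "\<dots> = (\<integral>\<^sup>+y. f (v * y) * normal_density 0 \<sigma> y \<partial>lborel)"
    by (subst nn_integral_cmult[symmetric]) (auto simp: d ennreal_mult mult_ac)
  finally show ?thesis ..
qed

lemma nn_integral_normal: "0 < \<sigma> \<Longrightarrow> (\<integral>\<^sup>+y. normal_density 0 \<sigma> y \<partial>lborel) = 1"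
  by (subst nn_integral_eq_integral) auto

text \<open>A linear form in independent centred normals is centred normal and the variances add.
  When all coefficients vanish the law is the point mass at 0, which has no density, hence the case
  distinction.\<close>

lemma nn_integral_normal_linear_form:
  fixes v :: "'i \<Rightarrow> real" and f :: "real \<Rightarrow> ennreal"
  assumes \<sigma>: "0 < \<sigma>" and I: "finite I" and f: "f \<in> borel_measurable borel"
  shows "(\<integral>\<^sup>+x. f (\<Sum>i\<in>I. v i * x i) * (\<Prod>i\<in>I. ennreal (normal_density 0 \<sigma> (x i))) \<partial>PiM I (\<lambda>_. lborel)) =
    (if \<forall>i\<in>I. v i = 0 then f 0
     else (\<integral>\<^sup>+t. f t * normal_density 0 (\<sigma> * sqrt (\<Sum>i\<in>I. (v i)\<^sup>2)) t \<partial>lborel))"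
  using I f
proof (induction I arbitrary: f rule: finite_induct)
  case empty
  then show ?case by (simp add: lborel_PiM.nn_integral_empty space_PiM)
next
  case (insert i I)
  note f[measurable] = \<open>f \<in> borel_measurable borel\<close>
  note [simp] = insert.hyps
  let ?N = "\<lambda>x. \<Prod>k\<in>I. ennreal (normal_density 0 \<sigma> (x k))"
  \<comment> \<open>The average of \<open>f\<close> over coordinate \<open>i\<close>, when the other
    coordinates contribute \<open>z\<close> to the form.\<close>
  define g where "g z = (\<integral>\<^sup>+y. f (v i * y + z) * normal_density 0 \<sigma> y \<partial>lborel)" for z
  have [measurable]: "g \<in> borel_measurable borel" unfolding g_def by measurable
  have "(\<integral>\<^sup>+x. f (\<Sum>k\<in>insert i I. v k * x k) * (\<Prod>k\<in>insert i I. ennreal (normal_density 0 \<sigma> (x k))) \<partial>PiM (insert i I) (\<lambda>_. lborel))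
    = (\<integral>\<^sup>+x. (\<integral>\<^sup>+y. f (\<Sum>k\<in>insert i I. v k * (x(i := y)) k) *
        (\<Prod>k\<in>insert i I. ennreal (normal_density 0 \<sigma> ((x(i := y)) k))) \<partial>lborel) \<partial>PiM I (\<lambda>_. lborel))"
    by (intro lborel_PiM.product_nn_integral_insert) auto
  also have "\<dots> = (\<integral>\<^sup>+x. g (\<Sum>k\<in>I. v k * x k) * ?N x \<partial>PiM I (\<lambda>_. lborel))"
  proof (rule nn_integral_cong)
    fix x :: "'i \<Rightarrow> real"
    have s: "(\<Sum>k\<in>I. v k * (x(i := y)) k) = (\<Sum>k\<in>I. v k * x k)" for y
      by (intro sum.cong) auto
    have p: "(\<Prod>k\<in>I. ennreal (normal_density 0 \<sigma> ((x(i := y)) k))) = ?N x" for y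
      by (intro prod.cong) auto
    have "(\<integral>\<^sup>+y. f (\<Sum>k\<in>insert i I. v k * (x(i := y)) k) *
        (\<Prod>k\<in>insert i I. ennreal (normal_density 0 \<sigma> ((x(i := y)) k))) \<partial>lborel)
      = (\<integral>\<^sup>+y. f (v i * y + (\<Sum>k\<in>I. v k * x k)) * normal_density 0 \<sigma> y * ?N x \<partial>lborel)"
      unfolding sum.insert[OF insert.hyps] prod.insert[OF insert.hyps] s p by (simp add: mult_ac)
    also have "\<dots> = g (\<Sum>k\<in>I. v k * x k) * ?N x"
      unfolding g_def by (intro nn_integral_multc) auto
    finally show "(\<integral>\<^sup>+y. f (\<Sum>k\<in>insert i I. v k * (x(i := y)) k) *
        (\<Prod>k\<in>insert i I. ennreal (normal_density 0 \<sigma> ((x(i := y)) k))) \<partial>lborel)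
      = g (\<Sum>k\<in>I. v k * x k) * ?N x" .
  qed
  also have "\<dots> = (if \<forall>k\<in>I. v k = 0 then g 0
     else (\<integral>\<^sup>+t. g t * normal_density 0 (\<sigma> * sqrt (\<Sum>k\<in>I. (v k)\<^sup>2)) t \<partial>lborel))"
    by (intro insert.IH) auto
  also have "\<dots> = (if \<forall>k\<in>insert i I. v k = 0 then f 0
     else (\<integral>\<^sup>+t. f t * normal_density 0 (\<sigma> * sqrt (\<Sum>k\<in>insert i I. (v k)\<^sup>2)) t \<partial>lborel))"
  proof (cases "v i = 0")
    case True
    then have "g = f" by (auto simp: g_def nn_integral_cmult nn_integral_normal[OF \<sigma>])
    then show ?thesis using True by simp
  next
    case vi: False
    have g: "g z = (\<integral>\<^sup>+t. f (t + z) * normal_density 0 (\<sigma> * \<bar>v i\<bar>) t \<partial>lborel)" for z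
      unfolding g_def using vi \<sigma> by (intro nn_integral_normal_scale[where f="\<lambda>t. f (t + z)"]) auto
    show ?thesis
    proof (cases "\<forall>k\<in>I. v k = 0")
      case True
      then show ?thesis using vi by (simp add: g)
    next
      case False
      define s where "s = \<sigma> * sqrt (\<Sum>k\<in>I. (v k)\<^sup>2)"
      define \<tau> where "\<tau> = \<sigma> * \<bar>v i\<bar>"
      have pos: "0 < (\<Sum>k\<in>I. (v k)\<^sup>2)" using False by (auto intro!: sum_pos2)
      then have s: "0 < s" and \<tau>: "0 < \<tau>" using vi \<sigma> by (auto simp: s_def \<tau>_def)
      have "sqrt (\<tau>\<^sup>2 + s\<^sup>2) = sqrt (\<sigma>\<^sup>2 * ((v i)\<^sup>2 + (\<Sum>k\<in>I. (v k)\<^sup>2)))"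
        using pos by (simp add: s_def \<tau>_def power_mult_distrib algebra_simps)
      also have "\<dots> = \<sigma> * sqrt (\<Sum>k\<in>insert i I. (v k)\<^sup>2)" using \<sigma> by (simp add: real_sqrt_mult)
      finally have e: "sqrt (\<tau>\<^sup>2 + s\<^sup>2) = \<sigma> * sqrt (\<Sum>k\<in>insert i I. (v k)\<^sup>2)" .
      \<comment> \<open>The substitution \<open>w = t + z\<close> exposes the convolution of two
        normal densities, once the integrations over \<open>w\<close> and \<open>z\<close> are
        exchanged.\<close>
      have shift: "g z = (\<integral>\<^sup>+w. f w * normal_density 0 \<tau> (w - z) \<partial>lborel)" for z
        unfolding g \<tau>_def[symmetric]
        by (subst (2) nn_integral_real_affine[where t=z and c=1]) (auto simp: add.commute)
      have "(\<integral>\<^sup>+z. g z * normal_density 0 s z \<partial>lborel) =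
          (\<integral>\<^sup>+z. (\<integral>\<^sup>+w. f w * normal_density 0 \<tau> (w - z) * normal_density 0 s z \<partial>lborel) \<partial>lborel)"
        unfolding shift by (intro nn_integral_cong nn_integral_multc[symmetric]) auto
      also have "\<dots> = (\<integral>\<^sup>+w. (\<integral>\<^sup>+z. f w * normal_density 0 \<tau> (w - z) * normal_density 0 s z \<partial>lborel) \<partial>lborel)"
        by (rule lborel_pair.Fubini') measurable
      also have "\<dots> = (\<integral>\<^sup>+w. f w * (\<integral>\<^sup>+z. ennreal (normal_density 0 \<tau> (w - z) * normal_density 0 s z) \<partial>lborel) \<partial>lborel)"
        by (intro nn_integral_cong, subst nn_integral_cmult[symmetric]) (auto simp: ennreal_mult mult_ac)
      also have "\<dots> = (\<integral>\<^sup>+w. f w * normal_density 0 (sqrt (\<tau>\<^sup>2 + s\<^sup>2)) w \<partial>lborel)"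
        using fun_cong[OF conv_normal_density_zero_mean[OF \<tau> s]] by simp
      finally show ?thesis using False vi unfolding e by (auto simp: s_def)
    qed
  qed
  finally show ?case .
qed

section \<open>The centred Gaussian as a test density\<close>

definition gauss_density :: "real \<Rightarrow> 'a::euclidean_space \<Rightarrow> real" where
  "gauss_density \<sigma> x = (\<Prod>b\<in>Basis. normal_density 0 \<sigma> (x \<bullet> b))"

lemma gauss_density_nonneg: "0 \<le> gauss_density \<sigma> x"
  by (simp add: gauss_density_def prod_nonneg)

lemma measurable_gauss_density[measurable]: "gauss_density \<sigma> \<in> borel_measurable borel"
  unfolding gauss_density_def by measurable

lemma gauss_density_eq:
  fixes x :: "'a::euclidean_space"
  assumes "0 < \<sigma>"
  shows "gauss_density \<sigma> x = exp (- (norm x)\<^sup>2 / (2 * \<sigma>\<^sup>2)) / (sqrt (2 * pi) * \<sigma>) ^ DIM('a)"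
proof -
  have "gauss_density \<sigma> x = (\<Prod>b\<in>(Basis::'a set). exp (- (x \<bullet> b)\<^sup>2 / (2 * \<sigma>\<^sup>2)) / (sqrt (2 * pi) * \<sigma>))"
    unfolding gauss_density_def using assms
    by (intro prod.cong) (auto simp: normal_density_def real_sqrt_mult)
  also have "\<dots> = exp (\<Sum>b\<in>(Basis::'a set). - (x \<bullet> b)\<^sup>2 / (2 * \<sigma>\<^sup>2)) / (sqrt (2 * pi) * \<sigma>) ^ DIM('a)"
    by (simp add: prod_dividef exp_sum)
  also have "(\<Sum>b\<in>(Basis::'a set). - (x \<bullet> b)\<^sup>2 / (2 * \<sigma>\<^sup>2)) = - (norm x)\<^sup>2 / (2 * \<sigma>\<^sup>2)"
    by (simp add: norm_eq_sqrt_inner[of x] euclidean_inner[of x x] power2_eq_square sum_nonneg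
        sum_negf flip: sum_divide_distrib)
  finally show ?thesis .
qed

lemma nn_integral_gauss_density:
  assumes "0 < \<sigma>"
  shows "(\<integral>\<^sup>+x. gauss_density \<sigma> (x::'a::euclidean_space) \<partial>lborel) = 1"
  unfolding gauss_density_def using assms
  using nn_integral_lborel_prod[where f="\<lambda>(_::'a) t. ennreal (normal_density 0 \<sigma> t)"]
  by (simp add: nn_integral_normal prod_ennreal)

lemma nn_integral_gauss_norm:
  fixes \<sigma> :: real
  assumes \<sigma>: "0 < \<sigma>"
  shows "(\<integral>\<^sup>+x. (norm x)\<^sup>2 * gauss_density \<sigma> (x::'a::euclidean_space) \<partial>lborel) = ennreal (DIM('a) * \<sigma>\<^sup>2)"
proof -
  have n2: "(norm x)\<^sup>2 = (\<Sum>b\<in>Basis. (x \<bullet> b)\<^sup>2)" for x :: 'a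
    by (simp add: norm_eq_sqrt_inner[of x] euclidean_inner[of x x] power2_eq_square sum_nonneg)
  have m2: "(\<integral>\<^sup>+t. t\<^sup>2 * normal_density 0 \<sigma> t \<partial>lborel) = ennreal (\<sigma>\<^sup>2)"
  proof -
    have "has_bochner_integral lborel (\<lambda>t. normal_density 0 \<sigma> t * t\<^sup>2) (\<sigma>\<^sup>2)"
      using normal_moment_even[of \<sigma> 0 1] \<sigma> by (simp add: fact_numeral)
    then have "(\<integral>\<^sup>+t. normal_density 0 \<sigma> t * t\<^sup>2 \<partial>lborel) = ennreal (\<sigma>\<^sup>2)"
      by (subst nn_integral_eq_integral) (auto simp: has_bochner_integral_iff)
    then show ?thesis by (simp add: mult.commute)
  qed
  have b: "(\<integral>\<^sup>+x. (x \<bullet> b)\<^sup>2 * gauss_density \<sigma> x \<partial>lborel) = ennreal (\<sigma>\<^sup>2)" if b: "b \<in> (Basis::'a set)" for b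
  proof -
    \<comment> \<open>The integrand is a product over coordinates in which only the factor of
      \<open>b\<close> carries the square.\<close>
    let ?f = "\<lambda>c t. if c = b then t\<^sup>2 * normal_density 0 \<sigma> t else normal_density 0 \<sigma> t"
    have "(x \<bullet> b)\<^sup>2 * gauss_density \<sigma> x = (\<Prod>c\<in>Basis. ?f c (x \<bullet> c))" for x :: 'a
      unfolding gauss_density_def prod.remove[OF finite_Basis b, where 'a=real]
      by (simp add: prod.If_cases mult_ac)
    then have "(\<integral>\<^sup>+x. (x \<bullet> b)\<^sup>2 * gauss_density \<sigma> x \<partial>lborel) = (\<Prod>c\<in>(Basis::'a set). \<integral>\<^sup>+t. ?f c t \<partial>lborel)"
      using nn_integral_lborel_prod[where f="\<lambda>(c::'a) t. ennreal (?f c t)"]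
      by (simp add: prod_ennreal)
    also have "\<dots> = (\<Prod>c\<in>(Basis::'a set). if c = b then ennreal (\<sigma>\<^sup>2) else 1)"
      by (intro prod.cong refl) (simp add: m2 nn_integral_normal[OF \<sigma>])
    also have "\<dots> = ennreal (\<sigma>\<^sup>2)" using b by (simp add: prod.delta)
    finally show ?thesis .
  qed
  have "(\<integral>\<^sup>+x. (norm x)\<^sup>2 * gauss_density \<sigma> (x::'a) \<partial>lborel) =
      (\<integral>\<^sup>+x. (\<Sum>b\<in>Basis. ennreal ((x \<bullet> b)\<^sup>2 * gauss_density \<sigma> (x::'a))) \<partial>lborel)"
    by (intro nn_integral_cong) (simp add: n2 sum_distrib_right gauss_density_nonneg)
  also have "\<dots> = (\<Sum>b\<in>(Basis::'a set). ennreal (\<sigma>\<^sup>2))"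
    by (subst nn_integral_sum) (auto simp: b)
  also have "\<dots> = ennreal (DIM('a) * \<sigma>\<^sup>2)" by (simp add: ennreal_mult ennreal_of_nat_eq_real_of_nat)
  finally show ?thesis .
qed

lemma nn_integral_gauss_linear_form:
  fixes u :: "'a::euclidean_space" and f :: "real \<Rightarrow> ennreal"
  assumes \<sigma>: "0 < \<sigma>" and [measurable]: "f \<in> borel_measurable borel"
  shows "(\<integral>\<^sup>+x. f (x \<bullet> u) * gauss_density \<sigma> x \<partial>lborel) =
    (if u = 0 then f 0 else (\<integral>\<^sup>+t. f t * normal_density 0 (\<sigma> * norm u) t \<partial>lborel))"
proof -
  have "(\<integral>\<^sup>+x. f (x \<bullet> u) * gauss_density \<sigma> x \<partial>lborel) =
      (\<integral>\<^sup>+x. f (\<Sum>b\<in>Basis. (b \<bullet> u) * x b) * (\<Prod>b\<in>(Basis::'a set). ennreal (normal_density 0 \<sigma> (x b))) \<partial>PiM Basis (\<lambda>_. lborel))"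
  proof -
    have "(\<Sum>b\<in>Basis. x b *\<^sub>R b) \<bullet> c = x c" if "c \<in> Basis" for x and c :: 'a
      using that by (simp add: inner_sum_left inner_Basis if_distrib[where f="(*) _"] cong: if_cong)
    then have "gauss_density \<sigma> (\<Sum>b\<in>(Basis::'a set). x b *\<^sub>R b) = (\<Prod>b\<in>(Basis::'a set). normal_density 0 \<sigma> (x b))" for x
      unfolding gauss_density_def by (intro prod.cong) auto
    moreover have "(\<Sum>b\<in>(Basis::'a set). x b *\<^sub>R b) \<bullet> u = (\<Sum>b\<in>Basis. (b \<bullet> u) * x b)" for x
      by (simp add: inner_sum_left mult.commute)
    ultimately show ?thesis by (subst nn_integral_lborel_PiM) (auto simp: prod_ennreal)
  qed
  also have "\<dots> = (if \<forall>b\<in>Basis. b \<bullet> u = 0 then f 0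
     else (\<integral>\<^sup>+t. f t * normal_density 0 (\<sigma> * sqrt (\<Sum>b\<in>Basis. (b \<bullet> u)\<^sup>2)) t \<partial>lborel))"
    by (intro nn_integral_normal_linear_form \<sigma>) auto
  also have "(\<forall>b\<in>Basis. b \<bullet> u = 0) \<longleftrightarrow> u = 0"
    using euclidean_all_zero_iff[of u] by (simp add: inner_commute)
  also have "sqrt (\<Sum>b\<in>Basis. (b \<bullet> u)\<^sup>2) = norm u"
    by (simp add: norm_eq_sqrt_inner[of u] euclidean_inner[of u u] power2_eq_square inner_commute)
  finally show ?thesis .
qed

lemma gauss_absolute_moment:
  fixes u :: "'a::euclidean_space"
  assumes \<sigma>: "0 < \<sigma>" and p: "0 < p"
  shows "(\<integral>\<^sup>+x. \<bar>x \<bullet> u\<bar> powr p * gauss_density \<sigma> x \<partial>lborel) =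
    ennreal ((\<sigma> * norm u) powr p) * (\<integral>\<^sup>+t. \<bar>t\<bar> powr p * normal_density 0 1 t \<partial>lborel)"
proof (cases "u = 0")
  case False
  let ?s = "\<sigma> * norm u"
  have s: "0 < ?s" using False \<sigma> by simp
  have "(\<integral>\<^sup>+x. \<bar>x \<bullet> u\<bar> powr p * gauss_density \<sigma> x \<partial>lborel) =
      (\<integral>\<^sup>+x. (\<lambda>t. ennreal (\<bar>t\<bar> powr p)) (x \<bullet> u) * gauss_density \<sigma> x \<partial>lborel)"
    by (simp add: ennreal_mult gauss_density_nonneg)
  also have "\<dots> = (\<integral>\<^sup>+t. ennreal (\<bar>t\<bar> powr p) * normal_density 0 ?s t \<partial>lborel)"
    using False \<sigma> by (subst nn_integral_gauss_linear_form) auto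
  also have "\<dots> = (\<integral>\<^sup>+t. ennreal (\<bar>?s * t\<bar> powr p) * normal_density 0 1 t \<partial>lborel)"
    using s by (subst nn_integral_normal_scale[where v="?s" and \<sigma>=1 and f="\<lambda>t. ennreal (\<bar>t\<bar> powr p)"]) auto
  also have "\<dots> = (\<integral>\<^sup>+t. ennreal (?s powr p) * ennreal (\<bar>t\<bar> powr p * normal_density 0 1 t) \<partial>lborel)"
  proof (intro nn_integral_cong)
    fix t
    have "\<bar>?s * t\<bar> powr p = ?s powr p * \<bar>t\<bar> powr p" using s by (simp add: abs_mult[of "?s"] powr_mult del: abs_mult)
    then show "ennreal (\<bar>?s * t\<bar> powr p) * normal_density 0 1 t =
        ennreal (?s powr p) * ennreal (\<bar>t\<bar> powr p * normal_density 0 1 t)"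
      by (simp add: ennreal_mult mult.assoc)
  qed
  also have "\<dots> = ennreal (?s powr p) * (\<integral>\<^sup>+t. \<bar>t\<bar> powr p * normal_density 0 1 t \<partial>lborel)"
    by (rule nn_integral_cmult) measurable
  finally show ?thesis .
qed (use p in simp)

text \<open>The Gibbs principle without logarithms. \<open>sqrt (2 * pi * exp 1) * \<sigma>\<close>
  to the power of the dimension is the exponential of the Gaussian entropy, and \<open>A\<close> is
  that times \<open>exp (- Q)\<close>. With \<open>?z\<close> chosen so that the density times
  \<open>A * exp ?z\<close> equals \<open>exp (- F x)\<close>, the tangent bound
  \<open>1 + ?z \<le> exp ?z\<close> is integrated against the Gaussian: the quadratic term has mean
  \<open>?k / 2\<close> and cancels, and \<open>F\<close> has mean at most \<open>Q\<close>, so the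
  integral of \<open>exp (- F x) / A\<close> is at least 1.\<close>

lemma gauss_entropy_bound:
  fixes F :: "'a::euclidean_space \<Rightarrow> real"
  assumes \<sigma>: "0 < \<sigma>" and [measurable]: "F \<in> borel_measurable borel" and F: "\<And>x. 0 \<le> F x"
    and Q: "0 \<le> Q" "(\<integral>\<^sup>+x. F x * gauss_density \<sigma> x \<partial>lborel) \<le> ennreal Q"
  shows "ennreal ((sqrt (2 * pi * exp 1) * \<sigma>) ^ DIM('a) * exp (- Q)) \<le> (\<integral>\<^sup>+x. exp (- F x) \<partial>lborel)"
proof -
  let ?k = "real DIM('a)"
  define A where "A = (sqrt (2 * pi * exp 1) * \<sigma>) ^ DIM('a) * exp (- Q)"
  have A: "0 < A" using \<sigma> by (simp add: A_def)
  have ek: "exp (?k / 2) = (sqrt (exp 1)) ^ DIM('a)"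
  proof -
    have "sqrt (exp 1) = exp (1 / 2 :: real)" by (intro real_sqrt_unique) (auto simp flip: exp_double)
    then show ?thesis by (simp flip: exp_of_nat_mult)
  qed
  have Ag: "gauss_density \<sigma> x * A = exp (?k / 2 - Q - (norm x)\<^sup>2 / (2 * \<sigma>\<^sup>2))" for x :: 'a
  proof -
    have "gauss_density \<sigma> x * A = exp (- (norm x)\<^sup>2 / (2 * \<sigma>\<^sup>2)) * exp (- Q) * exp (?k / 2)"
      unfolding gauss_density_eq[OF \<sigma>] A_def ek using \<sigma>
      by (simp add: real_sqrt_mult power_mult_distrib field_simps)
    also have "\<dots> = exp (?k / 2 - Q - (norm x)\<^sup>2 / (2 * \<sigma>\<^sup>2))"
      by (simp flip: exp_add)
    finally show ?thesis .
  qed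
  \<comment> \<open>The tangent bound rearranged so that every term on either side is nonnegative,
    as extended nonnegative integrals require.\<close>
  have pt: "(1 + Q) * gauss_density \<sigma> x + (norm x)\<^sup>2 * gauss_density \<sigma> x / (2 * \<sigma>\<^sup>2) \<le>
      exp (- F x) / A + F x * gauss_density \<sigma> x + ?k / 2 * gauss_density \<sigma> x" for x :: 'a
  proof -
    let ?z = "(norm x)\<^sup>2 / (2 * \<sigma>\<^sup>2) - F x - ?k / 2 + Q"
    have "gauss_density \<sigma> x * (1 + ?z) \<le> gauss_density \<sigma> x * exp ?z"
      by (intro mult_left_mono exp_ge_add_one_self gauss_density_nonneg)
    also have "gauss_density \<sigma> x * exp ?z = gauss_density \<sigma> x * A * exp ?z / A" using A by simp
    also have "\<dots> = exp (- F x) / A" unfolding Ag by (simp flip: exp_add)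
    finally show ?thesis by (simp add: algebra_simps)
  qed
  note g0 = gauss_density_nonneg[of \<sigma>]
  have "ennreal (1 + Q) + ennreal (?k / 2) =
      (\<integral>\<^sup>+x. ennreal ((1 + Q) * gauss_density \<sigma> (x::'a)) \<partial>lborel) +
      (\<integral>\<^sup>+x. ennreal ((norm x)\<^sup>2 * gauss_density \<sigma> (x::'a) / (2 * \<sigma>\<^sup>2)) \<partial>lborel)"
  proof -
    have "(\<integral>\<^sup>+x. ennreal ((1 + Q) * gauss_density \<sigma> (x::'a)) \<partial>lborel) = ennreal (1 + Q)"
    proof -
      have "(\<integral>\<^sup>+x. ennreal ((1 + Q) * gauss_density \<sigma> (x::'a)) \<partial>lborel) =
          (\<integral>\<^sup>+x. ennreal (1 + Q) * ennreal (gauss_density \<sigma> (x::'a)) \<partial>lborel)"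
        using Q g0 by (intro nn_integral_cong ennreal_mult) auto
      also have "\<dots> = ennreal (1 + Q) * (\<integral>\<^sup>+x. gauss_density \<sigma> (x::'a) \<partial>lborel)"
        by (rule nn_integral_cmult) measurable
      finally show ?thesis by (simp add: nn_integral_gauss_density[OF \<sigma>])
    qed
    moreover have "(\<integral>\<^sup>+x. ennreal ((norm x)\<^sup>2 * gauss_density \<sigma> (x::'a) / (2 * \<sigma>\<^sup>2)) \<partial>lborel)
      = (\<integral>\<^sup>+x. ennreal (1 / (2 * \<sigma>\<^sup>2)) * ennreal ((norm x)\<^sup>2 * gauss_density \<sigma> (x::'a)) \<partial>lborel)"
      using g0 by (intro nn_integral_cong) (subst ennreal_mult[symmetric], auto intro!: mult_nonneg_nonneg)
    moreover have "\<dots> = ennreal (1 / (2 * \<sigma>\<^sup>2)) * ennreal (?k * \<sigma>\<^sup>2)"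
      by (subst nn_integral_cmult) (auto simp: nn_integral_gauss_norm[OF \<sigma>])
    moreover have "\<dots> = ennreal (?k / 2)" using \<sigma> by (simp flip: ennreal_mult)
    ultimately show ?thesis by simp
  qed
  also have "\<dots> = (\<integral>\<^sup>+x. ennreal ((1 + Q) * gauss_density \<sigma> x + (norm x)\<^sup>2 * gauss_density \<sigma> x / (2 * \<sigma>\<^sup>2)) \<partial>(lborel::'a measure))"
    using Q g0
    by (subst nn_integral_add[symmetric]) (auto intro!: nn_integral_cong ennreal_plus[symmetric] mult_nonneg_nonneg divide_nonneg_nonneg simp del: ennreal_plus)
  also have "\<dots> \<le> (\<integral>\<^sup>+x. ennreal (exp (- F x) / A + F x * gauss_density \<sigma> x + ?k / 2 * gauss_density \<sigma> x) \<partial>(lborel::'a measure))"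
    by (intro nn_integral_mono ennreal_leI pt)
  also have "\<dots> = (\<integral>\<^sup>+x. ennreal (exp (- F x) / A) + ennreal (F x * gauss_density \<sigma> x) + ennreal (?k / 2 * gauss_density \<sigma> x) \<partial>(lborel::'a measure))"
  proof (intro nn_integral_cong)
    fix x :: 'a
    have "0 \<le> exp (- F x) / A" "0 \<le> F x * gauss_density \<sigma> x" "0 \<le> ?k / 2 * gauss_density \<sigma> x"
      using A F g0 by (auto intro!: mult_nonneg_nonneg)
    then show "ennreal (exp (- F x) / A + F x * gauss_density \<sigma> x + ?k / 2 * gauss_density \<sigma> x) =
        ennreal (exp (- F x) / A) + ennreal (F x * gauss_density \<sigma> x) + ennreal (?k / 2 * gauss_density \<sigma> x)"
      by (simp only: ennreal_plus add_nonneg_nonneg)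
  qed
  also have "\<dots> = (\<integral>\<^sup>+x. exp (- F x) / A \<partial>lborel) + (\<integral>\<^sup>+x. F x * gauss_density \<sigma> x \<partial>lborel)
      + (\<integral>\<^sup>+x. ?k / 2 * gauss_density \<sigma> x \<partial>(lborel::'a measure))"
    by (subst nn_integral_add, measurable, subst nn_integral_add, measurable)
  also have "(\<integral>\<^sup>+x. ?k / 2 * gauss_density \<sigma> x \<partial>(lborel::'a measure)) = ennreal (?k / 2)"
  proof -
    have "(\<integral>\<^sup>+x. ?k / 2 * gauss_density \<sigma> x \<partial>(lborel::'a measure)) =
        (\<integral>\<^sup>+x. ennreal (?k / 2) * ennreal (gauss_density \<sigma> x) \<partial>(lborel::'a measure))"
      using g0 by (intro nn_integral_cong ennreal_mult) auto
    also have "\<dots> = ennreal (?k / 2) * (\<integral>\<^sup>+x. gauss_density \<sigma> (x::'a) \<partial>lborel)"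
      by (rule nn_integral_cmult) measurable
    finally show ?thesis by (simp add: nn_integral_gauss_density[OF \<sigma>])
  qed
  also have "(\<integral>\<^sup>+x. exp (- F x) / A \<partial>lborel) + (\<integral>\<^sup>+x. F x * gauss_density \<sigma> x \<partial>lborel) + ennreal (?k / 2)
     \<le> (\<integral>\<^sup>+x. exp (- F x) / A \<partial>lborel) + ennreal Q + ennreal (?k / 2)"
    by (intro add_mono Q order_refl)
  finally have "ennreal (Q + ?k / 2) + ennreal 1 \<le> ennreal (Q + ?k / 2) + (\<integral>\<^sup>+x. exp (- F x) / A \<partial>lborel)"
    using Q by (simp add: ac_simps ennreal_plus)
  then have one: "ennreal 1 \<le> (\<integral>\<^sup>+x. exp (- F x) / A \<partial>lborel)"
    unfolding ennreal_add_left_cancel_le by simp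
  have "ennreal A * 1 \<le> ennreal A * (\<integral>\<^sup>+x. exp (- F x) / A \<partial>lborel)"
    using one by (intro mult_left_mono) auto
  also have "\<dots> = (\<integral>\<^sup>+x. ennreal A * ennreal (exp (- F x) / A) \<partial>lborel)"
    by (rule nn_integral_cmult[symmetric]) measurable
  also have "\<dots> = (\<integral>\<^sup>+x. exp (- F x) \<partial>lborel)"
    using A by (intro nn_integral_cong) (simp flip: ennreal_mult)
  finally show ?thesis by (simp add: A_def)
qed

section \<open>Integrals and moments of power type\<close>

text \<open>The tangent at \<open>x = 1\<close> to a concave power. It serves to compare exponents
  of the exponential profile and to interpolate between moments.\<close>

lemma powr_le_affine:
  fixes x s :: real
  assumes "0 \<le> x" "0 \<le> s" "s \<le> 1"
  shows "x powr s \<le> (1 - s) + s * x"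
proof (cases "x = 0")
  case False
  then show ?thesis using Youngs_inequality_0[of s "1 - s" x 1] assms by simp
qed (use assms in auto)

lemma ennreal_lincomb:
  "0 \<le> a \<Longrightarrow> 0 \<le> x \<Longrightarrow> 0 \<le> b \<Longrightarrow> 0 \<le> y \<Longrightarrow>
    ennreal a * ennreal x + ennreal b * ennreal y = ennreal (a * x + b * y)"
  by (simp add: ennreal_mult)

text \<open>The superlevel sets are intervals centred at 0, so after the layer-cake formula
  \<open>p\<close> survives only as the exponent \<open>1 / p\<close>.\<close>

lemma nn_integral_exp_powr:
  assumes p: "0 < p" and c: "0 < c"
  shows "(\<integral>\<^sup>+t. exp (- c * \<bar>t\<bar> powr p) \<partial>lborel) =
    (\<integral>\<^sup>+t. indicator {0<..<1} t * ennreal (2 * (- ln t / c) powr (1 / p)) \<partial>lborel)"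
proof -
  have "(\<integral>\<^sup>+t. exp (- c * \<bar>t\<bar> powr p) \<partial>lborel) =
      (\<integral>\<^sup>+t. indicator {0<..} t * emeasure lborel {y. t < exp (- c * \<bar>y\<bar> powr p)} \<partial>lborel)"
    by (intro nn_integral_superlevel) auto
  also have "\<dots> = (\<integral>\<^sup>+t. indicator {0<..<1} t * ennreal (2 * (- ln t / c) powr (1 / p)) \<partial>lborel)"
  proof (intro nn_integral_cong)
    fix t :: real
    consider "t \<le> 0" | "1 \<le> t" | "0 < t" "t < 1" by linarith
    then show "indicator {0<..} t * emeasure lborel {y. t < exp (- c * \<bar>y\<bar> powr p)} =
        indicator {0<..<1} t * ennreal (2 * (- ln t / c) powr (1 / p))"
    proof cases
      case 2
      have e1: "exp (- c * \<bar>y\<bar> powr p) \<le> 1" for y using c by simp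
      have "\<not> t < exp (- c * \<bar>y\<bar> powr p)" for y using 2 e1[of y] by linarith
      then have "{y. t < exp (- c * \<bar>y\<bar> powr p)} = {}" by auto
      then show ?thesis using 2 by simp
    next
      case 3
      define z where "z = - ln t / c"
      define R where "R = z powr (1 / p)"
      have "0 < z" unfolding z_def using 3 c ln_less_zero[of t] by (intro divide_pos_pos) auto
      then have R: "0 < R" "R powr p = z" using p by (auto simp: R_def powr_powr)
      have "t < exp (- c * \<bar>y\<bar> powr p) \<longleftrightarrow> \<bar>y\<bar> < R" for y
      proof -
        have "t < exp (- c * \<bar>y\<bar> powr p) \<longleftrightarrow> ln t < - c * \<bar>y\<bar> powr p"
          using 3 exp_less_cancel_iff[of "ln t" "- c * \<bar>y\<bar> powr p"] by simp
        also have "\<dots> \<longleftrightarrow> \<bar>y\<bar> powr p < R powr p"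
          unfolding R(2) z_def using c pos_less_divide_eq[OF c, of "\<bar>y\<bar> powr p" "- ln t"]
          by (simp add: mult.commute) linarith
        also have "\<dots> \<longleftrightarrow> \<bar>y\<bar> < R"
          using p R(1) powr_less_mono2[of p "\<bar>y\<bar>" R] powr_mono2[of p R "\<bar>y\<bar>"] by linarith
        finally show ?thesis .
      qed
      then have "{y. t < exp (- c * \<bar>y\<bar> powr p)} = {y. \<bar>y\<bar> < R}" by (simp only:)
      also have "\<dots> = {-R<..<R}" by auto
      finally show ?thesis using 3 R by (simp add: R_def z_def)
    qed simp
  qed
  finally show ?thesis .
qed

text \<open>
  By \<open>nn_integral_exp_powr\<close> the integral is an average of \<open>2 x powr (1 / p)\<close> over a probability measure
  not depending on \<open>p\<close>, so Bernoulli's inequality compares different exponents.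
\<close>

lemma nn_integral_exp_powr_le_2_mono:
  assumes p: "0 < p" "p \<le> q" and c: "0 < c" and le: "(\<integral>\<^sup>+t. exp (- c * \<bar>t\<bar> powr p) \<partial>lborel) \<le> 2"
  shows "(\<integral>\<^sup>+t. exp (- c * \<bar>t\<bar> powr q) \<partial>lborel) \<le> 2"
proof -
  define s where "s = p / q"
  have s: "0 \<le> s" "s \<le> 1" using p by (auto simp: s_def)
  have q: "0 < q" using p by simp
  let ?f = "\<lambda>t. ennreal (2 * (- ln t / c) powr (1 / p))"
  have "(\<integral>\<^sup>+t. exp (- c * \<bar>t\<bar> powr q) \<partial>lborel) =
      (\<integral>\<^sup>+t. indicator {0<..<1} t * ennreal (2 * (- ln t / c) powr (1 / q)) \<partial>lborel)"
    by (rule nn_integral_exp_powr[OF q c])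
  also have "\<dots> \<le> (\<integral>\<^sup>+t. ennreal (2 * (1 - s)) * indicator {0<..<1::real} t + ennreal s * (indicator {0<..<1} t * ?f t) \<partial>lborel)"
  proof (intro nn_integral_mono)
    fix t :: real
    have *: "2 * (- ln t / c) powr (1 / q) \<le> 2 * (1 - s) + s * (2 * (- ln t / c) powr (1 / p))"
      if "0 < t" "t < 1"
    proof -
      have "(- ln t / c) powr (1 / q) = ((- ln t / c) powr (1 / p)) powr s"
        unfolding powr_powr s_def using p by simp
      also have "\<dots> \<le> (1 - s) + s * ((- ln t / c) powr (1 / p))"
        using s by (intro powr_le_affine) auto
      finally show ?thesis by simp
    qed
    show "indicator {0<..<1} t * ennreal (2 * (- ln t / c) powr (1 / q)) \<le>
        ennreal (2 * (1 - s)) * indicator {0<..<1} t + ennreal s * (indicator {0<..<1} t * ?f t)"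
    proof (cases "0 < t \<and> t < 1")
      case True
      let ?x = "2 * (- ln t / c) powr (1 / p)"
      have "ennreal (2 * (- ln t / c) powr (1 / q)) \<le> ennreal (2 * (1 - s) * 1 + s * ?x)"
        using * True by (intro ennreal_leI) auto
      also have "\<dots> = ennreal (2 * (1 - s)) * ennreal 1 + ennreal s * ennreal ?x"
        using s by (intro ennreal_lincomb[symmetric]) auto
      finally show ?thesis using True by simp
    qed auto
  qed
  also have "\<dots> = ennreal (2 * (1 - s)) + ennreal s * (\<integral>\<^sup>+t. exp (- c * \<bar>t\<bar> powr p) \<partial>lborel)"
    unfolding nn_integral_exp_powr[OF p(1) c]
    by (subst nn_integral_add, measurable, subst nn_integral_cmult, measurable,
        subst nn_integral_cmult_indicator) auto
  also have "\<dots> \<le> ennreal (2 * (1 - s)) + ennreal s * 2"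
    using le by (intro add_left_mono mult_left_mono) auto
  also have "\<dots> = ennreal (2 * (1 - s) + s * 2)"
  proof -
    have "ennreal (s * 2) = ennreal s * 2" using s by (subst ennreal_mult) auto
    then show ?thesis using s by (subst ennreal_plus) auto
  qed
  finally show ?thesis by simp
qed

text \<open>The two half-lines overlap at 0, which gives an inequality of integrands. The form
  \<open>- 1 * \<bar>t\<bar> powr 1\<close> matches the general profile at \<open>c = 1\<close>,
  \<open>p = 1\<close>.\<close>

lemma nn_integral_exp_abs: "(\<integral>\<^sup>+t. exp (- 1 * \<bar>t\<bar> powr 1) \<partial>lborel) \<le> 2"
proof -
  let ?f = "\<lambda>t::real. ennreal (t ^ 0 * exp (- t)) * indicator {0..} t"
  have f: "(\<integral>\<^sup>+t. ?f t \<partial>lborel) = 1"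
    using nn_intergal_power_times_exp_Ici[of 0] by simp
  have "(\<integral>\<^sup>+t. exp (- 1 * \<bar>t\<bar> powr 1) \<partial>lborel) \<le> (\<integral>\<^sup>+t. ?f t + ?f (0 + (-1) * t) \<partial>lborel)"
    by (intro nn_integral_mono) (auto simp: indicator_def)
  also have "\<dots> = (\<integral>\<^sup>+t. ?f t \<partial>lborel) + (\<integral>\<^sup>+t. ?f (0 + (-1) * t) \<partial>lborel)"
    by (intro nn_integral_add) auto
  also have "(\<integral>\<^sup>+t. ?f (0 + (-1) * t) \<partial>lborel) = (\<integral>\<^sup>+t. ?f t \<partial>lborel)"
    by (subst (2) nn_integral_real_affine[where c="-1" and t=0]) auto
  also have "(\<integral>\<^sup>+t. ?f t \<partial>lborel) + (\<integral>\<^sup>+t. ?f t \<partial>lborel) = 2"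
    unfolding f by simp
  finally show ?thesis .
qed

text \<open>The integrand is twice the normal density of variance \<open>2 / pi\<close>; this is the
  origin of \<open>c = pi / 4\<close>.\<close>

lemma nn_integral_exp_square: "(\<integral>\<^sup>+t. exp (- (pi / 4) * \<bar>t\<bar> powr 2) \<partial>lborel) = 2"
proof -
  define s where "s = sqrt (2 / pi)"
  have s: "0 < s" "s\<^sup>2 = 2 / pi" by (auto simp: s_def)
  have "exp (- (pi / 4) * \<bar>t\<bar> powr 2) = 2 * normal_density 0 s t" for t
    unfolding normal_density_def s(2) by (simp add: powr_numeral)
  then have "(\<integral>\<^sup>+t. exp (- (pi / 4) * \<bar>t\<bar> powr 2) \<partial>lborel) = (\<integral>\<^sup>+t. 2 * ennreal (normal_density 0 s t) \<partial>lborel)"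
    by (intro nn_integral_cong) (simp add: ennreal_mult)
  also have "\<dots> = 2 * (\<integral>\<^sup>+t. normal_density 0 s t \<partial>lborel)"
    by (rule nn_integral_cmult) measurable
  also have "(\<integral>\<^sup>+t. normal_density 0 s t \<partial>lborel) = 1"
    using s by (subst nn_integral_eq_integral) auto
  finally show ?thesis by simp
qed

lemma log_concave_profile_exp_powr:
  assumes p: "1 \<le> p" and c: "0 \<le> c"
  shows "log_concave_profile (\<lambda>t. exp (- c * \<bar>t\<bar> powr p))"
  unfolding log_concave_profile_def
proof (intro conjI allI impI)
  fix s t a b :: real assume ab: "0 < a" "0 < b" "a + b = 1"
  \<comment> \<open>Covers the convex combinations with an endpoint at 0; the convexity of the power
    is invoked only for two positive arguments.\<close>
  have scale: "(a * x) powr p \<le> a * x powr p" if "0 < a" "a \<le> 1" "0 \<le> x" for a x :: real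
  proof -
    have "a powr p \<le> a powr 1" using that p by (intro powr_mono') auto
    then have "a powr p * x powr p \<le> a * x powr p" using that by (intro mult_right_mono) auto
    then show ?thesis using that by (simp add: powr_mult)
  qed
  have conv: "(a * x + b * y) powr p \<le> a * x powr p + b * y powr p" if xy: "0 \<le> x" "0 \<le> y" for x y
  proof -
    have a: "a = 1 - b" "a \<le> 1" "b \<le> 1" using ab by auto
    consider "x = 0" | "y = 0" | "0 < x" "0 < y" using xy by linarith
    then show ?thesis
    proof cases
      case 1
      then show ?thesis using scale[of b y] xy(2) ab(2) a(3) by simp
    next
      case 2
      then show ?thesis using scale[of a x] xy(1) ab(1) a(2) by simp
    next
      case 3
      then show ?thesis
        using convex_onD[OF powr_convex[OF p], of b x y] a(3) ab(2) unfolding a(1) by simp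
    qed
  qed
  have "\<bar>a * s + b * t\<bar> powr p \<le> (a * \<bar>s\<bar> + b * \<bar>t\<bar>) powr p"
    using ab p by (intro powr_mono2) (auto intro: order_trans[OF abs_triangle_ineq] simp: abs_mult)
  also have "\<dots> \<le> a * \<bar>s\<bar> powr p + b * \<bar>t\<bar> powr p" by (intro conv) auto
  finally have "c * \<bar>a * s + b * t\<bar> powr p \<le> c * (a * \<bar>s\<bar> powr p + b * \<bar>t\<bar> powr p)"
    using c by (rule mult_left_mono)
  show "exp (- c * \<bar>s\<bar> powr p) powr a * exp (- c * \<bar>t\<bar> powr p) powr b \<le> exp (- c * \<bar>a * s + b * t\<bar> powr p)"
  proof -
    have e: "exp z powr w = exp (w * z)" for w z :: real by (simp add: powr_def)
    show ?thesis unfolding e exp_add[symmetric]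
      using \<open>c * \<bar>a * s + b * t\<bar> powr p \<le> _\<close> by (simp add: algebra_simps)
  qed
qed (use c in auto)

section \<open>Absolute moments of the standard normal law\<close>

lemma nn_integral_normal_even_moment:
  "(\<integral>\<^sup>+t. t ^ (2 * n) * normal_density 0 1 t \<partial>lborel) = ennreal (fact (2 * n) / (2 ^ n * fact n))"
proof -
  have "(\<integral>\<^sup>+t. t ^ (2 * n) * normal_density 0 1 t \<partial>lborel) = (\<integral>\<^sup>+t. std_normal_density t * t ^ (2 * n) \<partial>lborel)"
    by (simp add: mult.commute)
  also have "\<dots> = ennreal (fact (2 * n) / (2 ^ n * fact n))"
    using std_normal_moment_even[of n]
    by (subst nn_integral_eq_integral) (auto simp: has_bochner_integral_iff)
  finally show ?thesis .
qed

text \<open>The quotient is the double factorial \<open>1 * 3 * ... * (2 n - 1)\<close>, which is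
  the even moment of order \<open>2 n\<close>.\<close>

lemma fact_double_Suc_ratio:
  "fact (2 * Suc n) / (2 ^ Suc n * fact (Suc n)) = real (2 * n + 1) * (fact (2 * n) / (2 ^ n * fact n))"
proof -
  have "fact (2 * Suc n) = (2 * (real n + 1)) * (real (2 * n + 1) * fact (2 * n))"
    by (simp add: algebra_simps)
  moreover have "2 ^ Suc n * fact (Suc n) = (2 * (real n + 1)) * (2 ^ n * fact n :: real)"
    by (simp add: algebra_simps)
  ultimately show ?thesis by (simp only: mult_divide_mult_cancel_left_if times_divide_eq_right) simp
qed

text \<open>Consecutive even moments have ratio \<open>c = 2 n + 1\<close>. The concave power is
  therefore replaced by its tangent at \<open>t\<^sup>2 = c\<close>: then \<open>t ^ (2 * n)\<close>
  and \<open>t ^ (2 * n) * t\<^sup>2 / c\<close> have the same mean and the weights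
  \<open>1 - \<tau>\<close> and \<open>\<tau>\<close> add up to 1. The result equals the bound given
  by log-convexity of moments.\<close>

lemma normal_moment_interpolation:
  fixes \<tau> :: real
  assumes \<tau>: "0 \<le> \<tau>" "\<tau> \<le> 1"
  shows "(\<integral>\<^sup>+t. \<bar>t\<bar> powr (2 * (real n + \<tau>)) * normal_density 0 1 t \<partial>lborel) \<le>
    ennreal (fact (2 * n) / (2 ^ n * fact n) * real (2 * n + 1) powr \<tau>)"
proof -
  define c where "c = real (2 * n + 1)"
  define M where "M = (fact (2 * n) / (2 ^ n * fact n) :: real)"
  have c: "0 < c" by (simp add: c_def)
  have M: "0 < M" by (simp add: M_def)
  have MS: "fact (2 * Suc n) / (2 ^ Suc n * fact (Suc n)) = c * M"
    unfolding M_def c_def by (rule fact_double_Suc_ratio)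
  have pt: "\<bar>t\<bar> powr (2 * (real n + \<tau>)) \<le> c powr \<tau> * (1 - \<tau>) * t ^ (2 * n) + c powr \<tau> * \<tau> / c * t ^ (2 * Suc n)" for t :: real
  proof (cases "t = 0")
    case True
    then show ?thesis using \<tau> c by (cases n) auto
  next
    case False
    have "\<bar>t\<bar> powr 2 = t\<^sup>2" using False by (simp add: powr_numeral)
    then have "\<bar>t\<bar> powr (2 * (real n + \<tau>)) = (t\<^sup>2) powr (real n + \<tau>)"
      using powr_powr[of "\<bar>t\<bar>" 2 "real n + \<tau>"] by simp
    also have "\<dots> = t ^ (2 * n) * (t\<^sup>2) powr \<tau>"
      using False by (simp add: powr_add powr_realpow power_mult)
    also have "(t\<^sup>2) powr \<tau> = c powr \<tau> * (t\<^sup>2 / c) powr \<tau>"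
      using c by (simp add: powr_divide)
    also have "t ^ (2 * n) * (c powr \<tau> * (t\<^sup>2 / c) powr \<tau>) \<le> t ^ (2 * n) * (c powr \<tau> * ((1 - \<tau>) + \<tau> * (t\<^sup>2 / c)))"
      using c \<tau> by (intro mult_left_mono powr_le_affine) auto
    also have "\<dots> = c powr \<tau> * (1 - \<tau>) * t ^ (2 * n) + c powr \<tau> * \<tau> / c * t ^ (2 * Suc n)"
      by (simp add: algebra_simps power2_eq_square)
    finally show ?thesis .
  qed
  have "(\<integral>\<^sup>+t. \<bar>t\<bar> powr (2 * (real n + \<tau>)) * normal_density 0 1 t \<partial>lborel) \<le>
      (\<integral>\<^sup>+t. ennreal (c powr \<tau> * (1 - \<tau>)) * ennreal (t ^ (2 * n) * normal_density 0 1 t) +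
        ennreal (c powr \<tau> * \<tau> / c) * ennreal (t ^ (2 * Suc n) * normal_density 0 1 t) \<partial>lborel)"
  proof (intro nn_integral_mono)
    fix t :: real
    have "\<bar>t\<bar> powr (2 * (real n + \<tau>)) * normal_density 0 1 t \<le>
        (c powr \<tau> * (1 - \<tau>)) * (t ^ (2 * n) * normal_density 0 1 t) + (c powr \<tau> * \<tau> / c) * (t ^ (2 * Suc n) * normal_density 0 1 t)"
      using mult_right_mono[OF pt[of t] normal_density_nonneg[of 0 1 t]] by (simp add: algebra_simps)
    moreover have "0 \<le> t ^ (2 * n) * normal_density 0 1 t" "0 \<le> t ^ (2 * Suc n) * normal_density 0 1 t"
      by (intro mult_nonneg_nonneg zero_le_even_power normal_density_nonneg, simp)+
    moreover have "0 \<le> c powr \<tau> * (1 - \<tau>)" "0 \<le> c powr \<tau> * \<tau> / c" using \<tau> c by auto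
    ultimately show "ennreal (\<bar>t\<bar> powr (2 * (real n + \<tau>)) * normal_density 0 1 t) \<le>
        ennreal (c powr \<tau> * (1 - \<tau>)) * ennreal (t ^ (2 * n) * normal_density 0 1 t) +
        ennreal (c powr \<tau> * \<tau> / c) * ennreal (t ^ (2 * Suc n) * normal_density 0 1 t)"
      by (simp only: ennreal_lincomb ennreal_leI)
  qed
  also have "\<dots> = ennreal (c powr \<tau> * (1 - \<tau>)) * ennreal M + ennreal (c powr \<tau> * \<tau> / c) * ennreal (c * M)"
    by (subst nn_integral_add, measurable, subst nn_integral_cmult, measurable, subst nn_integral_cmult, measurable)
      (simp only: nn_integral_normal_even_moment MS M_def[symmetric])
  also have "\<dots> = ennreal (M * c powr \<tau>)"
    using \<tau> c M by (subst ennreal_lincomb) (auto simp: algebra_simps)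
  finally show ?thesis by (simp add: M_def c_def)
qed

text \<open>Among the factors 1, 3, ..., \<open>2 n - 1\<close> the first is trivial, so only
  \<open>n - 1\<close> of them count. This saving leads to the exponent \<open>p / 2 - 1\<close>
  below, hence to the value 1 at \<open>p = 2\<close>.\<close>

lemma even_moment_le:
  assumes "1 \<le> n"
  shows "fact (2 * n) / (2 ^ n * fact n) \<le> real (2 * n + 1) ^ (n - 1)"
  using assms
proof (induction n rule: dec_induct)
  case (step n)
  have "fact (2 * Suc n) / (2 ^ Suc n * fact (Suc n)) = real (2 * n + 1) * (fact (2 * n) / (2 ^ n * fact n))"
    by (rule fact_double_Suc_ratio)
  also have "\<dots> \<le> real (2 * n + 1) * real (2 * n + 1) ^ (n - 1)"
    using step.IH by (intro mult_left_mono) auto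
  also have "\<dots> = real (2 * n + 1) ^ n" using step.hyps by (cases n) auto
  also have "\<dots> \<le> real (2 * Suc n + 1) ^ n" by (intro power_mono) auto
  finally show ?case by (simp only: diff_Suc_1)
qed simp

lemma normal_moment_le_one:
  assumes "0 \<le> p" "p \<le> 2"
  shows "(\<integral>\<^sup>+t. \<bar>t\<bar> powr p * normal_density 0 1 t \<partial>lborel) \<le> 1"
  using normal_moment_interpolation[of "p / 2" 0] assms by simp

text \<open>Write \<open>p / 2 = n + \<tau>\<close> with \<open>n\<close> its integer part. The base
  is \<open>2 n + 1 \<le> p + 1 \<le> 3 / 2 * p\<close>, the last step by
  \<open>2 \<le> p\<close>.\<close>

lemma normal_moment_le:
  assumes p: "2 \<le> p"
  shows "(\<integral>\<^sup>+t. \<bar>t\<bar> powr p * normal_density 0 1 t \<partial>lborel) \<le> ennreal ((3 / 2 * p) powr (p / 2 - 1))"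
proof -
  define n where "n = nat \<lfloor>p / 2\<rfloor>"
  define \<tau> where "\<tau> = p / 2 - real n"
  have fl: "1 \<le> \<lfloor>p / 2\<rfloor>" using p by (simp add: le_floor_iff)
  then have n: "1 \<le> n" "real n = of_int \<lfloor>p / 2\<rfloor>" unfolding n_def by linarith+
  have \<tau>: "0 \<le> \<tau>" "\<tau> \<le> 1" using n(2) by (auto simp: \<tau>_def) linarith+
  have p_eq: "p = 2 * (real n + \<tau>)" by (simp add: \<tau>_def)
  have "fact (2 * n) / (2 ^ n * fact n) * real (2 * n + 1) powr \<tau> \<le> real (2 * n + 1) ^ (n - 1) * real (2 * n + 1) powr \<tau>"
    by (intro mult_right_mono even_moment_le n) auto
  also have "\<dots> = real (2 * n + 1) powr (p / 2 - 1)"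
  proof -
    have e: "p / 2 - 1 = real (n - 1) + \<tau>" using n(1) by (simp add: \<tau>_def of_nat_diff)
    show ?thesis unfolding e by (simp add: powr_add powr_realpow)
  qed
  also have "\<dots> \<le> (3 / 2 * p) powr (p / 2 - 1)"
  proof (rule powr_mono2)
    show "real (2 * n + 1) \<le> 3 / 2 * p" using p \<tau>(1) unfolding \<tau>_def by simp
  qed (use p in auto)
  finally have le: "fact (2 * n) / (2 ^ n * fact n) * real (2 * n + 1) powr \<tau> \<le> (3 / 2 * p) powr (p / 2 - 1)" .
  show ?thesis
    using order_trans[OF normal_moment_interpolation[OF \<tau>, of n] ennreal_leI[OF le]] unfolding p_eq[symmetric] .
qed

section \<open>The volume bound\<close>

text \<open>The entropy bound meets the slab exchange: for \<open>?F\<close> the integral of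
  \<open>exp (- ?F x)\<close> is the integral of the product of profiles, and \<open>?Q\<close>
  dominates the Gaussian mean of \<open>?F\<close>. The parameters \<open>c\<close>,
  \<open>m\<close> and \<open>\<sigma>\<close> stay free so that both ranges of \<open>p\<close> are
  served.\<close>

lemma polytope_volume:
  fixes u :: "'s \<Rightarrow> 'a::euclidean_space"
  assumes T: "finite T" and p: "1 \<le> p" and c: "0 < c" and \<sigma>: "0 < \<sigma>" and m: "0 \<le> m"
    and int: "(\<integral>\<^sup>+t. exp (- c * \<bar>t\<bar> powr p) \<partial>lborel) \<le> 2"
    and mom: "(\<integral>\<^sup>+t. \<bar>t\<bar> powr p * normal_density 0 1 t \<partial>lborel) \<le> ennreal m"
  shows "ennreal ((sqrt (2 * pi * exp 1) * \<sigma>) ^ DIM('a) *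
      exp (- (c * m * \<sigma> powr p * (\<Sum>s\<in>T. norm (u s) powr p)))) \<le>
    emeasure lborel {x. \<forall>s\<in>T. \<bar>x \<bullet> u s\<bar> \<le> 1}"
proof -
  let ?Q = "c * m * \<sigma> powr p * (\<Sum>s\<in>T. norm (u s) powr p)"
  let ?F = "\<lambda>x. \<Sum>s\<in>T. c * \<bar>x \<bullet> u s\<bar> powr p"
  have "(\<integral>\<^sup>+x. ?F x * gauss_density \<sigma> x \<partial>lborel) =
      (\<integral>\<^sup>+x. (\<Sum>s\<in>T. ennreal c * ennreal (\<bar>x \<bullet> u s\<bar> powr p * gauss_density \<sigma> x)) \<partial>lborel)"
  proof (intro nn_integral_cong)
    fix x :: 'a
    have "ennreal (?F x * gauss_density \<sigma> x) = ennreal (\<Sum>s\<in>T. c * (\<bar>x \<bullet> u s\<bar> powr p * gauss_density \<sigma> x))"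
      by (simp add: sum_distrib_right mult.assoc)
    also have "\<dots> = (\<Sum>s\<in>T. ennreal (c * (\<bar>x \<bullet> u s\<bar> powr p * gauss_density \<sigma> x)))"
      using c by (intro sum_ennreal[symmetric] mult_nonneg_nonneg gauss_density_nonneg) auto
    also have "\<dots> = (\<Sum>s\<in>T. ennreal c * ennreal (\<bar>x \<bullet> u s\<bar> powr p * gauss_density \<sigma> x))"
      using c by (intro sum.cong refl ennreal_mult mult_nonneg_nonneg gauss_density_nonneg) auto
    finally show "ennreal (?F x * gauss_density \<sigma> x) = \<dots>" .
  qed
  also have "\<dots> = (\<Sum>s\<in>T. \<integral>\<^sup>+x. ennreal c * ennreal (\<bar>x \<bullet> u s\<bar> powr p * gauss_density \<sigma> x) \<partial>lborel)"
    by (intro nn_integral_sum) measurable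
  also have "\<dots> = (\<Sum>s\<in>T. ennreal c * (\<integral>\<^sup>+x. \<bar>x \<bullet> u s\<bar> powr p * gauss_density \<sigma> x \<partial>lborel))"
    by (intro sum.cong refl nn_integral_cmult) measurable
  also have "\<dots> \<le> (\<Sum>s\<in>T. ennreal (c * m * \<sigma> powr p * norm (u s) powr p))"
  proof (intro sum_mono)
    fix s
    have "(\<integral>\<^sup>+x. \<bar>x \<bullet> u s\<bar> powr p * gauss_density \<sigma> x \<partial>lborel) =
        ennreal ((\<sigma> * norm (u s)) powr p) * (\<integral>\<^sup>+t. \<bar>t\<bar> powr p * normal_density 0 1 t \<partial>lborel)"
      using p \<sigma> by (intro gauss_absolute_moment) auto
    also have "\<dots> \<le> ennreal ((\<sigma> * norm (u s)) powr p) * ennreal m"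
      by (intro mult_left_mono mom) auto
    finally have "ennreal c * (\<integral>\<^sup>+x. \<bar>x \<bullet> u s\<bar> powr p * gauss_density \<sigma> x \<partial>lborel) \<le>
        ennreal c * (ennreal ((\<sigma> * norm (u s)) powr p) * ennreal m)"
      by (intro mult_left_mono) auto
    also have "\<dots> = ennreal (c * ((\<sigma> * norm (u s)) powr p * m))"
      using c m by (simp only: ennreal_mult[symmetric] powr_ge_zero mult_nonneg_nonneg less_imp_le)
    also have "c * ((\<sigma> * norm (u s)) powr p * m) = c * m * \<sigma> powr p * norm (u s) powr p"
      using \<sigma> by (simp add: powr_mult)
    finally show "ennreal c * (\<integral>\<^sup>+x. \<bar>x \<bullet> u s\<bar> powr p * gauss_density \<sigma> x \<partial>lborel) \<le>
        ennreal (c * m * \<sigma> powr p * norm (u s) powr p)" .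
  qed
  also have "\<dots> = ennreal ?Q"
    using c m by (subst sum_ennreal) (auto simp: sum_distrib_left)
  finally have Q: "(\<integral>\<^sup>+x. ?F x * gauss_density \<sigma> x \<partial>lborel) \<le> ennreal ?Q" .
  have "ennreal ((sqrt (2 * pi * exp 1) * \<sigma>) ^ DIM('a) * exp (- ?Q)) \<le> (\<integral>\<^sup>+x. exp (- ?F x) \<partial>lborel)"
    using c m by (intro gauss_entropy_bound \<sigma> Q) (auto intro!: sum_nonneg mult_nonneg_nonneg)
  also have "\<dots> = (\<integral>\<^sup>+x. (\<Prod>s\<in>T. exp (- c * \<bar>x \<bullet> u s\<bar> powr p)) \<partial>lborel)"
    using T by (simp add: exp_sum sum_negf flip: sum_negf)
  also have "\<dots> \<le> emeasure lborel {x. \<forall>s\<in>T. \<bar>x \<bullet> u s\<bar> \<le> 1}"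
    using c by (intro peaked_polytope T int log_concave_profile_exp_powr p) auto
  finally show ?thesis .
qed

text \<open>The choice \<open>\<sigma> = y / r\<close> removes the vectors from the exponent: their
  \<open>p\<close>-th powers sum to \<open>CARD('k) * r powr p\<close>, so the whole lower bound
  becomes a perfect \<open>CARD('k)\<close>-th power and only the scalar \<open>y\<close> is left to
  optimise.\<close>

lemma polytope_volume_root:
  fixes u :: "'s \<Rightarrow> real ^ 'k" and p :: real and T :: "'s set"
  defines "r \<equiv> (1 / real CARD('k) * (\<Sum>s\<in>T. norm (u s) powr p)) powr (1 / p)"
    and "K \<equiv> {x :: real ^ 'k. \<forall>s\<in>T. \<bar>x \<bullet> u s\<bar> \<le> 1}"
  assumes T: "finite T" and p: "1 \<le> p" and c: "0 < c" and y: "0 < y" and m: "0 \<le> m" and r: "0 < r"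
    and int: "(\<integral>\<^sup>+t. exp (- c * \<bar>t\<bar> powr p) \<partial>lborel) \<le> 2"
    and mom: "(\<integral>\<^sup>+t. \<bar>t\<bar> powr p * normal_density 0 1 t \<partial>lborel) \<le> ennreal m"
    and fin: "emeasure lebesgue K \<noteq> \<infinity>"
  shows "sqrt (2 * pi * exp 1) * y * exp (- (c * m * y powr p)) / r \<le> measure lebesgue K powr (1 / real CARD('k))"
proof -
  let ?k = "CARD('k)"
  let ?V = "sqrt (2 * pi * exp 1) * y * exp (- (c * m * y powr p)) / r"
  let ?S = "\<Sum>s\<in>T. norm (u s) powr p"
  have "K \<in> sets borel"
  proof -
    have "K = (\<Inter>s\<in>T. {x. \<bar>x \<bullet> u s\<bar> \<le> 1})" by (auto simp: K_def)
    moreover have "closed {x. \<bar>x \<bullet> u s\<bar> \<le> 1}" for s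
      by (intro closed_Collect_le continuous_intros)
    ultimately show ?thesis by (auto intro!: borel_closed closed_INT)
  qed
  then have leb: "emeasure lebesgue K = emeasure lborel K" by simp
  have S: "0 \<le> ?S" by (intro sum_nonneg) auto
  have "r powr p = (1 / real ?k * ?S) powr (1 / p * p)"
    unfolding r_def powr_powr ..
  also have "\<dots> = 1 / real ?k * ?S" using p S by simp
  finally have rp: "?S = real ?k * r powr p" by simp
  have "c * m * (y / r) powr p * ?S = real ?k * (c * m * y powr p)"
    unfolding rp using y r by (simp add: powr_divide)
  then have "(sqrt (2 * pi * exp 1) * (y / r)) ^ ?k * exp (- (c * m * (y / r) powr p * ?S)) = ?V ^ ?k"
    by (simp add: power_mult_distrib power_divide flip: exp_of_nat_mult)
  then have "ennreal (?V ^ ?k) \<le> emeasure lborel K"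
    using polytope_volume[OF T p c _ m int mom, of "y / r" u] y r by (simp add: K_def)
  also have "\<dots> = ennreal (measure lebesgue K)"
    using fin unfolding leb[symmetric] by (intro emeasure_eq_ennreal_measure) simp
  finally have le: "?V ^ ?k \<le> measure lebesgue K" by (simp add: ennreal_le_iff)
  have V: "0 < ?V" using y r by simp
  have "v = (v ^ ?k) powr (1 / real ?k)" if "0 < v" for v :: real
    unfolding powr_realpow[OF that, symmetric] powr_powr using that by simp
  from this[OF V] have "?V = (?V ^ ?k) powr (1 / real ?k)" .
  also have "\<dots> \<le> measure lebesgue K powr (1 / real ?k)"
    using le V by (intro powr_mono2) auto
  finally show ?thesis .
qed

text \<open>\<open>measure\<close> is 0 on sets of infinite volume, so that case, in which the
  claimed bound is trivially true, is a disjunct of its own.\<close>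

theorem theorem2:
  fixes u :: "nat \<Rightarrow> real ^ 'k" and n :: nat and p :: real
  defines "r \<equiv> ((1 / real CARD('k)) * (\<Sum>i\<in>{1..n}. norm (u i) powr p)) powr (1 / p)"
  defines "K \<equiv> {x :: real ^ 'k. \<forall>i\<in>{1..n}. \<bar>x \<bullet> u i\<bar> \<le> 1}"
  assumes "CARD('k) \<le> n"
    and "1 \<le> p"
    and "r > 0"
  shows "emeasure lebesgue K = \<infinity> \<or>
         measure lebesgue K powr (1 / real CARD('k)) \<ge>
           (if p \<ge> 2 then 2 * sqrt 2 / (sqrt p * r) else 1 / r)"
proof (cases "emeasure lebesgue K = \<infinity>")
  case fin: False
  note bound = polytope_volume_root[OF finite_atLeastAtMost[of 1 n] \<open>1 \<le> p\<close> _ _ _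
      \<open>r > 0\<close>[unfolded r_def] _ _ fin[unfolded K_def], folded r_def K_def]
  have e: "2 \<le> exp (1::real)" "exp (1::real) \<le> 3" using exp_ge_add_one_self[of 1] exp_le by auto
  have pi3: "3 \<le> pi" using pi_gt3 by simp
  have "(if p \<ge> 2 then 2 * sqrt 2 / (sqrt p * r) else 1 / r) \<le> measure lebesgue K powr (1 / real CARD('k))"
  proof (cases "p \<ge> 2")
    case False
    \<comment> \<open>With \<open>y = c = m = 1\<close> the bound is
      \<open>sqrt (2 * pi * exp 1) / exp 1\<close> over \<open>r\<close>, and it suffices that
      \<open>exp 1 \<le> 2 * pi\<close>.\<close>
    have "exp 1 * exp 1 \<le> 2 * pi * exp (1::real)" using e pi3 by (intro mult_right_mono) auto
    then have "exp 1 \<le> sqrt (2 * pi * exp 1)" by (intro real_le_rsqrt) (simp add: power2_eq_square)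
    then have "1 \<le> sqrt (2 * pi * exp 1) * 1 * exp (- (1 * 1 * 1 powr p))"
      by (simp add: exp_minus field_simps)
    then have "1 / r \<le> sqrt (2 * pi * exp 1) * 1 * exp (- (1 * 1 * 1 powr p)) / r"
      using \<open>r > 0\<close> by (intro divide_right_mono) auto
    also have "\<dots> \<le> measure lebesgue K powr (1 / real CARD('k))"
    proof (rule bound)
      show "(\<integral>\<^sup>+t. exp (- 1 * \<bar>t\<bar> powr p) \<partial>lborel) \<le> 2"
        using \<open>1 \<le> p\<close> by (intro nn_integral_exp_powr_le_2_mono[OF _ _ _ nn_integral_exp_abs]) auto
      show "(\<integral>\<^sup>+t. \<bar>t\<bar> powr p * normal_density 0 1 t \<partial>lborel) \<le> ennreal 1"
        using normal_moment_le_one[of p] \<open>1 \<le> p\<close> False by simp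
    qed auto
    finally show ?thesis using False by simp
  next
    case True
    \<comment> \<open>\<open>y = r \<sigma>\<close> maximises \<open>y exp (- c m y\<^sup>p)\<close> for \<open>c = pi / 4\<close> and \<open>m = B\<^bsup>p / 2 - 1\<^esup>\<close>,
      an upper bound of the Gaussian moment.\<close>
    define B where "B = pi * exp 1 * p / 4"
    define y where "y = exp (1 / p) / sqrt B"
    \<comment> \<open>The estimate \<open>6 \<le> pi * exp 1\<close> places \<open>3 / 2 * p\<close>
      below \<open>B\<close>, so the Gaussian moment is at most
      \<open>B powr (p / 2 - 1)\<close>.\<close>
    have "3 * 2 \<le> pi * exp 1" using e pi3 by (intro mult_mono) auto
    then have "3 * 2 * p \<le> pi * exp 1 * p" using True by (intro mult_right_mono) auto
    then have B: "3 / 2 * p \<le> B" "0 < B" using True by (auto simp: B_def)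
    have y: "0 < y" using B by (simp add: y_def)
    have "y powr p = exp 1 / B powr (p / 2)"
      using True B by (simp add: y_def powr_divide powr_powr exp_powr_real flip: powr_half_sqrt)
    then have "B powr (p / 2 - 1) * y powr p = exp 1 / B"
      using B by (simp add: powr_diff)
    then have "pi / 4 * B powr (p / 2 - 1) * y powr p = 1 / p"
      using True B by (simp add: B_def field_simps)
    \<comment> \<open>The exponent is \<open>- 1 / p\<close> and cancels the factor
      \<open>exp (1 / p)\<close> in \<open>y\<close>.\<close>
    then have "sqrt (2 * pi * exp 1) * y * exp (- (pi / 4 * B powr (p / 2 - 1) * y powr p)) = sqrt (2 * pi * exp 1) / sqrt B"
      by (simp add: y_def exp_minus)
    also have "\<dots> = sqrt (8 / p)" unfolding B_def real_sqrt_divide[symmetric] by (simp add: field_simps)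
    also have "\<dots> = 2 * sqrt 2 / sqrt p"
      using real_sqrt_mult[of 4 2] by (simp add: real_sqrt_divide)
    finally have "2 * sqrt 2 / (sqrt p * r) = sqrt (2 * pi * exp 1) * y * exp (- (pi / 4 * B powr (p / 2 - 1) * y powr p)) / r"
      by simp
    also have "\<dots> \<le> measure lebesgue K powr (1 / real CARD('k))"
    proof (rule bound)
      show "(\<integral>\<^sup>+t. exp (- (pi / 4) * \<bar>t\<bar> powr p) \<partial>lborel) \<le> 2"
        by (rule nn_integral_exp_powr_le_2_mono[of 2]) (use True nn_integral_exp_square in auto)
      have "(3 / 2 * p) powr (p / 2 - 1) \<le> B powr (p / 2 - 1)"
        using True B by (intro powr_mono2) auto
      then show "(\<integral>\<^sup>+t. \<bar>t\<bar> powr p * normal_density 0 1 t \<partial>lborel) \<le> ennreal (B powr (p / 2 - 1))"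
        by (intro order_trans[OF normal_moment_le[OF True]] ennreal_leI)
    qed (use y in auto)
    finally show ?thesis using True by simp
  qed
  then show ?thesis by blast
qed simp

end
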